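(* Let $n$ be even and let $G$ be the random graph on vertex set $\{0,\dots,n-1\}$ whose edge set is $C\cup M$, where $C$ consists of the $n$ edges of the cycle $0,1,\dots,n-1,0$ and $M$ is a random perfect matching of the vertex set. Let $\pi$ be a uniformly random ordering of the vertices. There is a constant $\delta>0$ independent of $n$ such that with probability $1-e^{-\Omega(n)}$ (over both $M$ and $\pi$), the subgraph induced on $T_3(G,\pi)$ has a connected component with at least $\delta n$ vertices.
   Context: For a graph $G$ and an ordering $\pi$ of its vertices, $T_3(G,\pi)$ is the set of vertices having at most two neighbors preceding them in $\pi$, viewed also as the induced subgraph of $G$ on this set. *)

theory Defs
  imports "HOL-Probability.Probability" "HOL-Combinatorics.Multiset_Permutations"
begin

text \<open>A simple graph is given by a vertex set and a set of two-element subsets of it, so that a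
  matching edge that coincides with a cycle edge is counted only once in the union below.\<close>

definition cycle_edges :: "nat \<Rightarrow> nat set set" where
  "cycle_edges n = {{i, (i + 1) mod n} | i. i < n}"

definition perfect_matchings :: "'a set \<Rightarrow> 'a set set set" where
  "perfect_matchings V = {M. (\<forall>e\<in>M. e \<subseteq> V \<and> card e = 2) \<and> (\<forall>v\<in>V. \<exists>!e. e \<in> M \<and> v \<in> e)}"

text \<open>An ordering of a finite set is a list enumerating it without repetition, earlier elements
  preceding later ones.\<close>

definition precedes :: "'a list \<Rightarrow> 'a \<Rightarrow> 'a \<Rightarrow> bool" where
  "precedes \<pi> u v \<longleftrightarrow> (\<exists>i j. i < j \<and> j < length \<pi> \<and> \<pi> ! i = u \<and> \<pi> ! j = v)"

definition T3 :: "'a set \<Rightarrow> 'a set set \<Rightarrow> 'a list \<Rightarrow> 'a set" where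
  "T3 V E \<pi> = {v \<in> V. card {u \<in> V. {u, v} \<in> E \<and> precedes \<pi> u v} \<le> 2}"

definition induced_edges :: "'a set set \<Rightarrow> 'a set \<Rightarrow> 'a set set" where
  "induced_edges E S = {e \<in> E. e \<subseteq> S}"

definition connected_components :: "'a set \<Rightarrow> 'a set set \<Rightarrow> 'a set set" where
  "connected_components V E = V // {(u, v) \<in> V \<times> V. (u, v) \<in> {(x, y). {x, y} \<in> E}\<^sup>*}"

text \<open>The matching and the ordering are independent and uniform. The lemmas below show that
  the set of matchings is finite and, for even \<open>n\<close>, nonempty, as \<^const>\<open>pmf_of_set\<close> requires.\<close>

definition random_matching_and_order :: "nat \<Rightarrow> (nat set set \<times> nat list) pmf" where
  "random_matching_and_order n =
     pair_pmf (pmf_of_set (perfect_matchings {..<n})) (pmf_of_set (permutations_of_set {..<n}))"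

lemma finite_perfect_matchings: "finite V \<Longrightarrow> finite (perfect_matchings V)"
  by (rule finite_subset[of _ "Pow (Pow V)"]) (auto simp: perfect_matchings_def)

lemma perfect_matchings_nonempty:
  fixes n :: nat
  assumes "even n"
  shows "perfect_matchings {..<n} \<noteq> {}"
proof -
  define e where "e k = {2 * k, 2 * k + 1}" for k :: nat
  have mem: "v \<in> e k \<longleftrightarrow> k = v div 2" for v k
    unfolding e_def insert_iff empty_iff by presburger
  have bound: "v < n \<longleftrightarrow> v div 2 < n div 2" for v
    using assms by presburger
  have "\<exists>!f. f \<in> e ` {..<n div 2} \<and> v \<in> f" if "v \<in> {..<n}" for v
    by (rule ex1I[of _ "e (v div 2)"]) (use that bound[of v] in \<open>auto simp: mem\<close>)
  moreover have "\<forall>f \<in> e ` {..<n div 2}. f \<subseteq> {..<n}"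
    by (auto simp: mem bound)
  moreover have "card (e k) = 2" for k
    by (simp add: e_def)
  ultimately have "e ` {..<n div 2} \<in> perfect_matchings {..<n}"
    by (simp add: perfect_matchings_def)
  then show ?thesis by blast
qed

end

theory Submission
  imports Defs
begin

text \<open>
  A vertex is outside \<open>T3\<close> if it has three neighbours and comes after all of them. About a quarter
  of the vertices are of this kind, and deleting that many vertices from an almost cubic graph leaves average
  degree 2, which is exactly critical. But with probability exponentially close to 1 linearly many
  vertices become isolated, and they lower the average, so that the rest of \<open>T3\<close> has average
  degree at least \<open>2 + \<epsilon>\<close> on a linear number of vertices. If all components were small, a union
  \<open>U\<close> of some of the dense ones would have between \<open>\<delta> n\<close> and \<open>2 \<delta> n\<close> vertices and average
  degree at least \<open>2 + \<epsilon>\<close>. If \<open>U\<close> consists of \<open>s\<close> intervals of the cycle, then at least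
  \<open>s + \<epsilon> |U| / 4\<close> matching edges lie inside \<open>U\<close>. Each interval costs a factor \<open>n\<close> in the number
  of choices of \<open>U\<close>, which is paid for by one matching edge, and the remaining \<open>\<epsilon> |U| / 4\<close> edges
  make the union bound over \<open>U\<close> exponentially small when \<open>\<delta>\<close> is small.

  Concentration over the ordering uses that the orders induced on disjoint sets are
  independent: the events that a vertex is a local maximum, or that its neighbours are, depend on
  balls of bounded size, and the vertices split into boundedly many classes with disjoint balls.
\<close>

section \<open>Perfect matchings\<close>

lemma perfect_matchingsI:
  assumes "\<And>e. e \<in> M \<Longrightarrow> e \<subseteq> V" "\<And>e. e \<in> M \<Longrightarrow> card e = 2"
    and "\<And>v. v \<in> V \<Longrightarrow> \<exists>!e. e \<in> M \<and> v \<in> e"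
  shows "M \<in> perfect_matchings V"
  using assms by (simp add: perfect_matchings_def)

lemma perfect_matchings_image_subset:
  assumes "bij_betw f A B"
  shows "(`) ((`) f) ` perfect_matchings A \<subseteq> perfect_matchings B"
proof
  fix M' assume "M' \<in> (`) ((`) f) ` perfect_matchings A"
  then obtain M where M: "M \<in> perfect_matchings A" and M': "M' = (`) f ` M" by auto
  have inj: "inj_on f A" and im: "f ` A = B" using assms by (auto simp: bij_betw_def)
  have sub: "e \<subseteq> A" "card e = 2" if "e \<in> M" for e
    using M that by (auto simp: perfect_matchings_def)
  have "e \<subseteq> B \<and> card e = 2" if e: "e \<in> M'" for e
  proof -
    obtain e' where e': "e' \<in> M" "e = f ` e'" using e unfolding M' by blast
    have "card (f ` e') = card e'" using inj_on_subset[OF inj sub(1)[OF e'(1)]] by (rule card_image)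
    then show ?thesis using sub[OF e'(1)] e'(2) im by auto
  qed
  moreover have "\<exists>!e. e \<in> M' \<and> v \<in> e" if v: "v \<in> B" for v
  proof -
    obtain a where a: "a \<in> A" "v = f a" using v im by blast
    have "\<exists>!e. e \<in> M \<and> a \<in> e" using M a(1) by (simp add: perfect_matchings_def)
    then obtain e where e: "e \<in> M" "a \<in> e" "\<And>e'. e' \<in> M \<Longrightarrow> a \<in> e' \<Longrightarrow> e' = e" by metis
    show ?thesis
    proof (rule ex1I[of _ "f ` e"])
      show "f ` e \<in> M' \<and> v \<in> f ` e" using e(1,2) a(2) unfolding M' by blast
      fix g assume "g \<in> M' \<and> v \<in> g"
      then obtain e' where e': "e' \<in> M" "g = f ` e'" "v \<in> f ` e'" unfolding M' by blast
      then have "a \<in> e'" using inj_on_image_mem_iff[OF inj a(1) sub(1)[OF e'(1)]] a(2) by simp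
      then show "g = f ` e" using e(3)[OF e'(1)] e'(2) by simp
    qed
  qed
  ultimately show "M' \<in> perfect_matchings B" unfolding perfect_matchings_def by blast
qed

lemma card_perfect_matchings_cong:
  fixes A B :: "'a set"
  assumes "finite A" "finite B" "card A = card B"
  shows "card (perfect_matchings A) = card (perfect_matchings B)"
proof -
  have le: "card (perfect_matchings A) \<le> card (perfect_matchings B)"
    if fin: "finite A" "finite B" and eq: "card A = card B" for A B :: "'a set"
  proof -
    obtain f where f: "bij_betw f A B" using fin eq finite_same_card_bij by blast
    then have inj: "inj_on f A" by (simp add: bij_betw_def)
    have "inj_on ((`) f) (Pow A)" using inj by (rule inj_on_image_Pow)
    then have "inj_on ((`) ((`) f)) (Pow (Pow A))" by (rule inj_on_image_Pow)
    then have "inj_on ((`) ((`) f)) (perfect_matchings A)"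
      by (rule inj_on_subset) (auto simp: perfect_matchings_def)
    then show ?thesis
      using card_inj_on_le[OF _ perfect_matchings_image_subset[OF f]] finite_perfect_matchings fin
      by blast
  qed
  from le[OF assms] le[OF assms(2,1) assms(3)[symmetric]] show ?thesis by simp
qed

section \<open>Counting the matchings that contain prescribed edges\<close>

lemma perfect_matchings_remove_edge:
  assumes "M \<in> perfect_matchings V" "e \<in> M"
  shows "M - {e} \<in> perfect_matchings (V - e)"
proof -
  have uniq: "e1 = e2" if "e1 \<in> M" "e2 \<in> M" "v \<in> e1" "v \<in> e2" for e1 e2 v
    using assms that unfolding perfect_matchings_def by blast
  have "f \<subseteq> V - e" "card f = 2" if "f \<in> M - {e}" for f
    using assms(1) that uniq[OF _ assms(2), of f] unfolding perfect_matchings_def by blast+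
  moreover have "\<exists>!f. f \<in> M - {e} \<and> v \<in> f" if "v \<in> V - e" for v
    using assms that unfolding perfect_matchings_def by blast
  ultimately show ?thesis by (rule perfect_matchingsI)
qed

lemma perfect_matchings_insert_edge:
  assumes "M \<in> perfect_matchings (V - e)" "e \<subseteq> V" "card e = 2"
  shows "insert e M \<in> perfect_matchings V" "e \<notin> M"
proof -
  have sub: "f \<subseteq> V - e" "card f = 2" if "f \<in> M" for f
    using assms(1) that unfolding perfect_matchings_def by blast+
  have "e \<noteq> {}" using assms(3) by auto
  then show "e \<notin> M" using sub(1) by blast
  have "\<exists>!f. f \<in> insert e M \<and> v \<in> f" if v: "v \<in> V" for v
  proof (cases "v \<in> e")
    case True
    then show ?thesis using sub(1) by blast
  next
    case False
    then have "\<exists>!f. f \<in> M \<and> v \<in> f" using assms(1) v unfolding perfect_matchings_def by blast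
    then show ?thesis using False by auto
  qed
  moreover have "f \<subseteq> V" "card f = 2" if "f \<in> insert e M" for f
    using that sub assms(2,3) by auto
  ultimately show "insert e M \<in> perfect_matchings V" by (intro perfect_matchingsI)
qed

text \<open>Matchings are classified by the partner \<open>c\<close> of \<open>a\<close>. Removing
  \<open>{a, c}\<close> leaves a vertex set of the same size for every \<open>c\<close>, so the
  \<open>card V - 1\<close> disjoint classes are equally large.\<close>

lemma card_perfect_matchings_remove_pair:
  assumes "finite V" "a \<in> V" "b \<in> V" "a \<noteq> b"
  shows "(card V - 1) * card (perfect_matchings (V - {a, b})) \<le> card (perfect_matchings V)"
proof -
  let ?F = "\<lambda>c. insert {a, c} ` perfect_matchings (V - {a, c})"
  have fin: "finite (perfect_matchings W)" if "W \<subseteq> V" for W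
    using that assms(1) by (meson finite_perfect_matchings finite_subset)
  have card: "card (?F c) = card (perfect_matchings (V - {a, b}))" if "c \<in> V - {a}" for c
  proof -
    have c: "{a, c} \<subseteq> V" "card {a, c} = 2" using that assms(2) by auto
    have "inj_on (insert {a, c}) (perfect_matchings (V - {a, c}))"
      using perfect_matchings_insert_edge(2)[OF _ c] by (metis (no_types, lifting) inj_onI insert_ident)
    then have "card (?F c) = card (perfect_matchings (V - {a, c}))" by (rule card_image)
    also have "\<dots> = card (perfect_matchings (V - {a, b}))"
      using that assms by (intro card_perfect_matchings_cong) (auto simp: card_Diff_subset)
    finally show ?thesis .
  qed
  have uniq: "e = {a, c}" if "N \<in> ?F c" "c \<in> V - {a}" "e \<in> N" "a \<in> e" for N c e
    using that unfolding perfect_matchings_def by blast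
  have disj: "?F c \<inter> ?F d = {}" if "c \<in> V - {a}" "d \<in> V - {a}" "c \<noteq> d" for c d
  proof (rule ccontr)
    assume "?F c \<inter> ?F d \<noteq> {}"
    then obtain N where N: "N \<in> ?F c" "N \<in> ?F d" by blast
    then have "{a, c} \<in> N" by auto
    then have "{a, c} = {a, d}" using uniq[OF N(2) that(2)] by blast
    then show False using that(3) by (auto simp: doubleton_eq_iff)
  qed
  have "(card V - 1) * card (perfect_matchings (V - {a, b})) = (\<Sum>c\<in>V - {a}. card (?F c))"
    using card assms by simp
  also have "\<dots> = card (\<Union>c\<in>V - {a}. ?F c)"
    using assms(1) fin disj by (intro card_UN_disjoint[symmetric]) auto
  also have "\<dots> \<le> card (perfect_matchings V)"
  proof (intro card_mono fin UN_least image_subsetI)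
    fix c M assume "c \<in> V - {a}" "M \<in> perfect_matchings (V - {a, c})"
    then show "insert {a, c} M \<in> perfect_matchings V"
      using assms(2) by (intro perfect_matchings_insert_edge(1)) auto
  qed simp
  finally show ?thesis .
qed

text \<open>When the edges of \<open>F\<close> are exposed one at a time, each is present with
  conditional probability at most 1 over the number of remaining vertices minus one. The hypothesis
  keeps that denominator at least \<open>x\<close> up to the last edge.\<close>

lemma card_perfect_matchings_superset:
  assumes "finite V" "finite F" "2 * card F + x \<le> card V + 1"
  shows "card {M \<in> perfect_matchings V. F \<subseteq> M} * x ^ card F \<le> card (perfect_matchings V)"
  using assms(2,1,3)
proof (induction F arbitrary: V rule: finite_induct)
  case empty
  then show ?case by simp
next
  case (insert e F)
  show ?case
  proof (cases "e \<subseteq> V \<and> card e = 2")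
    case False
    then have "{M \<in> perfect_matchings V. insert e F \<subseteq> M} = {}"
      unfolding perfect_matchings_def by blast
    then show ?thesis by (metis card.empty mult_zero_left zero_le)
  next
    case True
    then have e: "e \<subseteq> V" "card e = 2" by auto
    obtain a b where ab: "e = {a, b}" "a \<noteq> b" using e(2) by (auto simp: card_2_iff)
    have cV: "card (V - e) = card V - 2" "card V \<ge> 2"
      using e insert.prems(1) card_mono[OF insert.prems(1) e(1)]
      by (auto simp: card_Diff_subset finite_subset)
    let ?A = "{M \<in> perfect_matchings V. insert e F \<subseteq> M}"
    let ?B = "{M \<in> perfect_matchings (V - e). F \<subseteq> M}"
    have "card ?A \<le> card ?B"
    proof (rule card_inj_on_le[of "\<lambda>M. M - {e}"])
      show "inj_on (\<lambda>M. M - {e}) ?A" by (rule inj_onI) blast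
      show "(\<lambda>M. M - {e}) ` ?A \<subseteq> ?B"
        using perfect_matchings_remove_edge[of _ V e] insert.hyps(2) by auto
      show "finite ?B" using insert.prems(1) finite_perfect_matchings[of "V - e"] by simp
    qed
    then have "card ?A * x ^ card F \<le> card ?B * x ^ card F" by simp
    also have "\<dots> \<le> card (perfect_matchings (V - e))"
      using insert cV by (intro insert.IH) auto
    finally have "x * (card ?A * x ^ card F) \<le> x * card (perfect_matchings (V - e))" by simp
    also have "\<dots> \<le> (card V - 1) * card (perfect_matchings (V - e))"
      using insert by (intro mult_right_mono) auto
    also have "\<dots> \<le> card (perfect_matchings V)"
      using card_perfect_matchings_remove_pair[of V a b] insert.prems(1) e(1) ab by auto
    finally show ?thesis using insert.hyps by (simp add: mult_ac)
  qed
qed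

text \<open>A union bound over the \<open>k\<close>-element subsets of \<open>H\<close>. As
  \<open>4 * k \<le> card V\<close>, the denominators are at least
  \<open>card V - 2 * k \<ge> card V / 2\<close>, so each prescribed edge costs a factor
  \<open>2 / card V\<close>.\<close>

lemma card_perfect_matchings_many_edges:
  assumes "finite V" "V \<noteq> {}" "finite H" "4 * k \<le> card V"
  shows "real (card {M \<in> perfect_matchings V. k \<le> card (M \<inter> H)})
    \<le> real (card H choose k) * (2 / real (card V)) ^ k * real (card (perfect_matchings V))"
proof -
  let ?P = "perfect_matchings V" and ?n = "card V"
  let ?\<F> = "{F. F \<subseteq> H \<and> card F = k}"
  have n: "?n > 0" using assms by (simp add: card_gt_0_iff)
  have finP: "finite ?P" using assms(1) by (rule finite_perfect_matchings)
  have fin\<F>: "finite ?\<F>" using assms(3) by (auto intro: finite_subset[of _ "Pow H"])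
  have sub: "{M \<in> ?P. k \<le> card (M \<inter> H)} \<subseteq> (\<Union>F\<in>?\<F>. {M \<in> ?P. F \<subseteq> M})"
  proof
    fix M assume M: "M \<in> {M \<in> ?P. k \<le> card (M \<inter> H)}"
    then have "k \<le> card (M \<inter> H)" by simp
    then obtain F where "F \<subseteq> M \<inter> H" "card F = k" "finite F"
      by (rule obtain_subset_with_card_n)
    with M show "M \<in> (\<Union>F\<in>?\<F>. {M \<in> ?P. F \<subseteq> M})" by blast
  qed
  have each: "real (card {M \<in> ?P. F \<subseteq> M}) \<le> (2 / ?n) ^ k * card ?P" if "F \<in> ?\<F>" for F
  proof -
    have F: "finite F" "card F = k" using that assms(3) by (auto intro: finite_subset)
    have "card {M \<in> ?P. F \<subseteq> M} * (?n - 2 * k) ^ k \<le> card ?P"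
      using card_perfect_matchings_superset[OF assms(1) F(1), of "?n - 2 * k"] F(2) assms(4) by auto
    then have "real (card {M \<in> ?P. F \<subseteq> M}) * real (?n - 2 * k) ^ k \<le> card ?P"
      by (metis of_nat_le_iff of_nat_mult of_nat_power)
    moreover have "(real ?n / 2) ^ k \<le> real (?n - 2 * k) ^ k"
      using assms(4) by (intro power_mono) auto
    ultimately have "real (card {M \<in> ?P. F \<subseteq> M}) * (real ?n / 2) ^ k \<le> card ?P"
      by (meson mult_left_mono of_nat_0_le_iff order_trans)
    then show ?thesis using n by (simp add: power_divide field_simps)
  qed
  have "real (card {M \<in> ?P. k \<le> card (M \<inter> H)}) \<le> real (card (\<Union>F\<in>?\<F>. {M \<in> ?P. F \<subseteq> M}))"
    using card_mono[OF _ sub] fin\<F> finP by auto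
  also have "\<dots> \<le> (\<Sum>F\<in>?\<F>. real (card {M \<in> ?P. F \<subseteq> M}))"
    using card_UN_le[OF fin\<F>, of "\<lambda>F. {M \<in> ?P. F \<subseteq> M}"]
    unfolding of_nat_sum[symmetric] of_nat_le_iff .
  also have "\<dots> \<le> real (card ?\<F>) * ((2 / ?n) ^ k * card ?P)"
    using each by (rule sum_bounded_above)
  also have "card ?\<F> = card H choose k" using n_subsets[OF assms(3)] .
  finally show ?thesis by (simp add: mult_ac)
qed

text \<open>The binomial coefficient is at most \<open>N ^ k / fact k\<close>, and
  \<open>1 / fact k \<le> exp t / t ^ k\<close> because \<open>t ^ k / fact k\<close> is one term of
  the series of \<open>exp t\<close>. The free parameter \<open>t\<close> is chosen later so as to
  make \<open>r / t\<close> small.\<close>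

lemma choose_mult_power_le_exp:
  fixes q t :: real
  assumes "t > 0" "q \<ge> 0" "real N * q \<le> r"
  shows "real (N choose k) * q ^ k \<le> exp t * (r / t) ^ k"
proof -
  have "t ^ k / fact k \<le> exp t"
    using exp_lower_Taylor_quadratic assms(1) sum_le_suminf[OF summable_exp[of t], of "{k}"]
    by (simp add: exp_def scaleR_conv_of_real field_simps)
  then have "(t ^ k / fact k) * (r / t) ^ k \<le> exp t * (r / t) ^ k"
    using assms order_trans[OF _ assms(3), of 0] by (intro mult_right_mono) auto
  then have ge: "r ^ k / fact k \<le> exp t * (r / t) ^ k"
    using assms(1) by (simp add: power_divide)
  have "real (N choose k) \<le> real N ^ k / fact k"
    using binomial_fact_pow[of N k]
    by (simp add: field_simps) (metis of_nat_fact of_nat_le_iff of_nat_mult of_nat_power)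
  then have "real (N choose k) * q ^ k \<le> real N ^ k / fact k * q ^ k"
    using assms(2) by (intro mult_right_mono) auto
  also have "\<dots> = (real N * q) ^ k / fact k" by (simp add: power_mult_distrib)
  also have "\<dots> \<le> r ^ k / fact k"
    using assms by (intro divide_right_mono power_mono) auto
  finally show ?thesis using ge by simp
qed

section \<open>Uniformly random orderings\<close>

lemma precedes_Nil [simp]: "\<not> precedes [] u v"
  by (simp add: precedes_def)

lemma precedes_Cons:
  "precedes (x # xs) u v \<longleftrightarrow> (x = u \<and> v \<in> set xs) \<or> precedes xs u v"
proof
  assume "precedes (x # xs) u v"
  then obtain i j where ij: "i < j" "j < Suc (length xs)" "(x # xs) ! i = u" "(x # xs) ! j = v"
    by (auto simp: precedes_def)
  then obtain j' where j: "j = Suc j'" by (cases j) auto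
  show "(x = u \<and> v \<in> set xs) \<or> precedes xs u v"
  proof (cases i)
    case 0
    then show ?thesis using ij j by auto
  next
    case (Suc i')
    then show ?thesis using ij j unfolding precedes_def by auto
  qed
next
  assume "(x = u \<and> v \<in> set xs) \<or> precedes xs u v"
  then show "precedes (x # xs) u v"
  proof
    assume "x = u \<and> v \<in> set xs"
    then obtain j where "x = u" "j < length xs" "xs ! j = v" by (auto simp: in_set_conv_nth)
    then show ?thesis unfolding precedes_def by (intro exI[of _ 0] exI[of _ "Suc j"]) auto
  next
    assume "precedes xs u v"
    then obtain i j where "i < j" "j < length xs" "xs ! i = u" "xs ! j = v"
      by (auto simp: precedes_def)
    then show ?thesis unfolding precedes_def by (intro exI[of _ "Suc i"] exI[of _ "Suc j"]) auto
  qed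
qed

lemma precedes_append:
  "precedes (xs @ ys) u v \<longleftrightarrow>
     precedes xs u v \<or> precedes ys u v \<or> (u \<in> set xs \<and> v \<in> set ys)"
  by (induction xs) (auto simp: precedes_Cons)

lemma precedes_in_set: "precedes xs u v \<Longrightarrow> u \<in> set xs \<and> v \<in> set xs"
  by (induction xs) (auto simp: precedes_Cons)

lemma precedes_filter:
  "precedes (filter Q xs) u v \<longleftrightarrow> Q u \<and> Q v \<and> precedes xs u v"
  by (induction xs) (auto simp: precedes_Cons)

lemma precedes_asym: "distinct xs \<Longrightarrow> precedes xs u v \<Longrightarrow> \<not> precedes xs v u"
  by (induction xs) (auto simp: precedes_Cons dest: precedes_in_set)

section \<open>Averages over orderings, and independence on disjoint sets\<close>

definition order_mean :: "'a set \<Rightarrow> ('a list \<Rightarrow> real) \<Rightarrow> real" where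
  "order_mean V f = (\<Sum>\<pi>\<in>permutations_of_set V. f \<pi>) / fact (card V)"

text \<open>Plain finite averages reduce independence to counting shuffles. The change from
  \<open>measure_pmf.prob\<close> is made only once, in
  \<open>prob_random_matching_and_order\<close>.\<close>

definition order_prob :: "'a set \<Rightarrow> ('a list \<Rightarrow> bool) \<Rightarrow> real" where
  "order_prob V Q = order_mean V (\<lambda>\<pi>. of_bool (Q \<pi>))"

lemma order_mean_mono:
  "(\<And>\<pi>. \<pi> \<in> permutations_of_set V \<Longrightarrow> f \<pi> \<le> g \<pi>) \<Longrightarrow> order_mean V f \<le> order_mean V g"
  unfolding order_mean_def by (intro divide_right_mono sum_mono) auto

lemma order_mean_cong:
  "(\<And>\<pi>. \<pi> \<in> permutations_of_set V \<Longrightarrow> f \<pi> = g \<pi>) \<Longrightarrow> order_mean V f = order_mean V g"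
  unfolding order_mean_def by simp

lemma order_mean_const: "finite V \<Longrightarrow> order_mean V (\<lambda>_. c) = c"
  by (simp add: order_mean_def)

lemma order_mean_linear:
  "finite V \<Longrightarrow> order_mean V (\<lambda>\<pi>. a + b * f \<pi>) = a + b * order_mean V f"
  by (simp add: order_mean_def sum.distrib sum_distrib_left[symmetric] add_divide_distrib)

lemma order_prob_eq_card:
  "order_prob V Q = card {\<pi> \<in> permutations_of_set V. Q \<pi>} / fact (card V)"
  by (simp add: order_prob_def order_mean_def sum.If_cases of_bool_def Int_def)

lemma order_prob_mono:
  "(\<And>\<pi>. \<pi> \<in> permutations_of_set V \<Longrightarrow> Q \<pi> \<Longrightarrow> R \<pi>) \<Longrightarrow> order_prob V Q \<le> order_prob V R"
  unfolding order_prob_def by (intro order_mean_mono) auto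

lemma order_prob_disj_le: "order_prob V (\<lambda>\<pi>. Q \<pi> \<or> R \<pi>) \<le> order_prob V Q + order_prob V R"
proof -
  have "order_prob V (\<lambda>\<pi>. Q \<pi> \<or> R \<pi>) \<le> order_mean V (\<lambda>\<pi>. of_bool (Q \<pi>) + of_bool (R \<pi>))"
    unfolding order_prob_def by (intro order_mean_mono) auto
  then show ?thesis
    by (simp add: order_prob_def order_mean_def sum.distrib add_divide_distrib)
qed

lemma order_prob_Bex_le:
  "finite I \<Longrightarrow> order_prob V (\<lambda>\<pi>. \<exists>i\<in>I. Q i \<pi>) \<le> (\<Sum>i\<in>I. order_prob V (Q i))"
proof (induction I rule: finite_induct)
  case empty
  then show ?case by (simp add: order_prob_eq_card)
next
  case (insert i I)
  then show ?case
    using order_prob_disj_le[of V "Q i" "\<lambda>\<pi>. \<exists>i\<in>I. Q i \<pi>"] by simp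
qed

text \<open>Every ordering of \<open>V\<close> is a shuffle of an ordering of \<open>A\<close> with
  one of \<open>V - A\<close>, and all such pairs have the same number of shuffles, a binomial
  coefficient. Hence the two restricted orders are independent and uniform.\<close>

lemma order_mean_split:
  assumes "finite V" "A \<subseteq> V"
  shows "order_mean V (\<lambda>\<pi>. f (filter (\<lambda>x. x \<in> A) \<pi>) * g (filter (\<lambda>x. x \<notin> A) \<pi>))
    = order_mean A f * order_mean (V - A) g"
proof -
  let ?P = "permutations_of_set A" and ?Q = "permutations_of_set (V - A)"
  let ?h = "\<lambda>\<pi>. f (filter (\<lambda>x. x \<in> A) \<pi>) * g (filter (\<lambda>x. x \<notin> A) \<pi>)"
  have finA: "finite A" using assms finite_subset by blast
  have setD: "set \<alpha> = A" "distinct \<alpha>" if "\<alpha> \<in> ?P" for \<alpha>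
    using that by (auto dest: permutations_of_setD)
  have setD': "set \<beta> = V - A" "distinct \<beta>" if "\<beta> \<in> ?Q" for \<beta>
    using that by (auto dest: permutations_of_setD)
  \<comment> \<open>Filtering recovers both lists from a shuffle, which makes the shuffle sets of
    different pairs disjoint.\<close>
  have filt: "filter (\<lambda>x. x \<in> A) \<pi> = \<alpha>" "filter (\<lambda>x. x \<notin> A) \<pi> = \<beta>"
    if "\<alpha> \<in> ?P" "\<beta> \<in> ?Q" "\<pi> \<in> shuffles \<alpha> \<beta>" for \<alpha> \<beta> \<pi>
    using filter_shuffles_disjoint1[of \<alpha> \<beta> \<pi>] that setD[of \<alpha>] setD'[of \<beta>] by auto
  have perms: "permutations_of_set V = (\<Union>(\<alpha>, \<beta>)\<in>?P \<times> ?Q. shuffles \<alpha> \<beta>)"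
  proof (rule set_eqI)
    fix \<pi>
    show "\<pi> \<in> permutations_of_set V \<longleftrightarrow> \<pi> \<in> (\<Union>(\<alpha>, \<beta>)\<in>?P \<times> ?Q. shuffles \<alpha> \<beta>)"
    proof
      assume "\<pi> \<in> permutations_of_set V"
      then have \<pi>: "set \<pi> = V" "distinct \<pi>" by (auto dest: permutations_of_setD)
      have "filter (\<lambda>x. x \<in> A) \<pi> \<in> ?P" "filter (\<lambda>x. x \<notin> A) \<pi> \<in> ?Q"
        using \<pi> assms(2) by (auto intro!: permutations_of_setI)
      then show "\<pi> \<in> (\<Union>(\<alpha>, \<beta>)\<in>?P \<times> ?Q. shuffles \<alpha> \<beta>)"
        using partition_in_shuffles[of \<pi> "\<lambda>x. x \<in> A"] by blast
    next
      assume "\<pi> \<in> (\<Union>(\<alpha>, \<beta>)\<in>?P \<times> ?Q. shuffles \<alpha> \<beta>)"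
      then obtain \<alpha> \<beta> where *: "\<alpha> \<in> ?P" "\<beta> \<in> ?Q" "\<pi> \<in> shuffles \<alpha> \<beta>" by blast
      show "\<pi> \<in> permutations_of_set V"
        using set_shuffles[OF *(3)] distinct_disjoint_shuffles[OF _ _ _ *(3)]
          setD[OF *(1)] setD'[OF *(2)] assms(2) by (auto intro!: permutations_of_setI)
    qed
  qed
  have "(\<Sum>\<pi>\<in>permutations_of_set V. ?h \<pi>) = (\<Sum>(\<alpha>, \<beta>)\<in>?P \<times> ?Q. \<Sum>\<pi>\<in>shuffles \<alpha> \<beta>. ?h \<pi>)"
    unfolding perms
  proof (subst sum.UNION_disjoint)
    show "\<forall>i\<in>?P \<times> ?Q. \<forall>j\<in>?P \<times> ?Q. i \<noteq> j \<longrightarrow>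
        (case i of (\<alpha>, \<beta>) \<Rightarrow> shuffles \<alpha> \<beta>) \<inter> (case j of (\<alpha>, \<beta>) \<Rightarrow> shuffles \<alpha> \<beta>) = {}"
    proof (intro ballI impI, rule ccontr)
      fix i j assume i: "i \<in> ?P \<times> ?Q" and j: "j \<in> ?P \<times> ?Q" and "i \<noteq> j"
        and "(case i of (\<alpha>, \<beta>) \<Rightarrow> shuffles \<alpha> \<beta>) \<inter> (case j of (\<alpha>, \<beta>) \<Rightarrow> shuffles \<alpha> \<beta>) \<noteq> {}"
      then obtain \<pi> where "\<pi> \<in> shuffles (fst i) (snd i)" "\<pi> \<in> shuffles (fst j) (snd j)"
        by (auto simp: case_prod_unfold)
      then have "fst i = fst j" "snd i = snd j"
        using filt[of "fst i" "snd i" \<pi>] filt[of "fst j" "snd j" \<pi>] i j by auto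
      then show False using \<open>i \<noteq> j\<close> by (simp add: prod_eq_iff)
    qed
  qed (auto simp: case_prod_unfold)
  also have "\<dots> = (\<Sum>(\<alpha>, \<beta>)\<in>?P \<times> ?Q. real (card V choose card A) * (f \<alpha> * g \<beta>))"
  proof (intro sum.cong refl)
    fix p assume p: "p \<in> ?P \<times> ?Q"
    obtain \<alpha> \<beta> where p': "p = (\<alpha>, \<beta>)" "\<alpha> \<in> ?P" "\<beta> \<in> ?Q" using p by blast
    have "length \<alpha> = card A" "length \<beta> = card V - card A"
      using setD[OF p'(2)] setD'[OF p'(3)] assms(2) finA distinct_card[of \<alpha>] distinct_card[of \<beta>]
      by (auto simp: card_Diff_subset)
    moreover have "card A \<le> card V" using assms by (simp add: card_mono)
    ultimately have "card (shuffles \<alpha> \<beta>) = card V choose card A"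
      using card_disjoint_shuffles[of \<alpha> \<beta>] setD(1)[OF p'(2)] setD'(1)[OF p'(3)] by simp
    moreover have "(\<Sum>\<pi>\<in>shuffles \<alpha> \<beta>. ?h \<pi>) = (\<Sum>\<pi>\<in>shuffles \<alpha> \<beta>. f \<alpha> * g \<beta>)"
      using filt[OF p'(2,3)] by (intro sum.cong refl) simp
    ultimately show "(case p of (\<alpha>, \<beta>) \<Rightarrow> \<Sum>\<pi>\<in>shuffles \<alpha> \<beta>. ?h \<pi>)
        = (case p of (\<alpha>, \<beta>) \<Rightarrow> real (card V choose card A) * (f \<alpha> * g \<beta>))"
      using p'(1) by simp
  qed
  also have "\<dots> = real (card V choose card A) * (sum f ?P * sum g ?Q)"
    unfolding sum_product sum.cartesian_product
    by (simp only: sum_distrib_left case_prod_unfold)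
  finally show ?thesis
    using assms finA binomial_fact[of "card A" "card V", where 'a = real]
    by (simp add: order_mean_def card_Diff_subset card_mono)
qed

lemma order_mean_prod_disjoint:
  assumes "finite J" "finite V" "\<And>j. j \<in> J \<Longrightarrow> B j \<subseteq> V" "disjoint_family_on B J"
  shows "order_mean V (\<lambda>\<pi>. \<Prod>j\<in>J. f j (filter (\<lambda>x. x \<in> B j) \<pi>)) = (\<Prod>j\<in>J. order_mean (B j) (f j))"
  using assms
proof (induction J arbitrary: V rule: finite_induct)
  case empty
  then show ?case by (simp add: order_mean_const)
next
  case (insert j J)
  have disj: "B i \<inter> B j = {}" if "i \<in> J" for i
    using insert.prems(3) insert.hyps(2) that by (auto simp: disjoint_family_on_def)
  have "filter (\<lambda>x. x \<in> B i) (filter (\<lambda>x. x \<notin> B j) \<pi>) = filter (\<lambda>x. x \<in> B i) \<pi>"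
    if "i \<in> J" for i \<pi>
    using disj[OF that] by (auto intro!: filter_cong)
  then have "order_mean V (\<lambda>\<pi>. \<Prod>j\<in>insert j J. f j (filter (\<lambda>x. x \<in> B j) \<pi>))
      = order_mean V (\<lambda>\<pi>. f j (filter (\<lambda>x. x \<in> B j) \<pi>) *
          (\<Prod>i\<in>J. f i (filter (\<lambda>x. x \<in> B i) (filter (\<lambda>x. x \<notin> B j) \<pi>))))"
    using insert.hyps by (intro order_mean_cong) simp
  also have "\<dots> = order_mean (B j) (f j) *
      order_mean (V - B j) (\<lambda>\<pi>. \<Prod>i\<in>J. f i (filter (\<lambda>x. x \<in> B i) \<pi>))"
    using insert.prems order_mean_split[of V "B j" "f j"
        "\<lambda>\<pi>. \<Prod>i\<in>J. f i (filter (\<lambda>x. x \<in> B i) \<pi>)"] by auto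
  also have "order_mean (V - B j) (\<lambda>\<pi>. \<Prod>i\<in>J. f i (filter (\<lambda>x. x \<in> B i) \<pi>))
      = (\<Prod>i\<in>J. order_mean (B i) (f i))"
    using insert.prems disj by (intro insert.IH) (auto simp: disjoint_family_on_def)
  finally show ?case using insert.hyps by simp
qed

text \<open>The orders induced on disjoint sets are independent; this is the exponential-moment bound
  for sums of indicators that each depend on one of them.\<close>

lemma order_prob_count_ge:
  fixes s a k :: real
  assumes "finite J" "finite V" "\<And>j. j \<in> J \<Longrightarrow> B j \<subseteq> V" "disjoint_family_on B J"
    and a: "\<And>j. j \<in> J \<Longrightarrow> (exp s - 1) * order_prob (B j) (P j) \<le> a"
  shows "order_prob V (\<lambda>\<pi>. k \<le> s * card {j \<in> J. P j (filter (\<lambda>x. x \<in> B j) \<pi>)})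
    \<le> exp (a * card J - k)"
proof -
  let ?f = "\<lambda>j xs. 1 + (exp s - 1) * of_bool (P j xs) :: real"
  have count: "exp (s * card {j \<in> J. P j (filter (\<lambda>x. x \<in> B j) \<pi>)})
      = (\<Prod>j\<in>J. ?f j (filter (\<lambda>x. x \<in> B j) \<pi>))" for \<pi>
  proof -
    have "(\<Prod>j\<in>J. ?f j (filter (\<lambda>x. x \<in> B j) \<pi>))
        = (\<Prod>j\<in>J. if P j (filter (\<lambda>x. x \<in> B j) \<pi>) then exp s else 1)"
      by (intro prod.cong) auto
    also have "\<dots> = exp s ^ card {j \<in> J. P j (filter (\<lambda>x. x \<in> B j) \<pi>)}"
      using assms(1) by (simp add: prod.If_cases Int_def)
    finally show ?thesis by (simp add: exp_of_nat_mult[symmetric] mult.commute)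
  qed
  \<comment> \<open>Markov's inequality for the exponential of \<open>s\<close> times the count; a
    negative \<open>s\<close> yields lower tails.\<close>
  have "order_prob V (\<lambda>\<pi>. k \<le> s * card {j \<in> J. P j (filter (\<lambda>x. x \<in> B j) \<pi>)})
      \<le> order_mean V (\<lambda>\<pi>. 0 + exp (- k) * (\<Prod>j\<in>J. ?f j (filter (\<lambda>x. x \<in> B j) \<pi>)))"
    unfolding order_prob_def count[symmetric]
    by (intro order_mean_mono) (auto simp: exp_add[symmetric])
  also have "\<dots> = exp (- k) * (\<Prod>j\<in>J. order_mean (B j) (?f j))"
    using order_mean_prod_disjoint[OF assms(1-4), of ?f] assms(2)
    by (subst order_mean_linear) simp_all
  also have "(\<Prod>j\<in>J. order_mean (B j) (?f j)) \<le> (\<Prod>j\<in>J. exp a)"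
  proof (rule prod_mono)
    fix j assume j: "j \<in> J"
    then have "finite (B j)" using assms(2,3) finite_subset by blast
    then have mean: "order_mean (B j) (?f j) = 1 + (exp s - 1) * order_prob (B j) (P j)"
      by (simp add: order_mean_linear order_prob_def)
    have "0 \<le> order_mean (B j) (?f j)"
      unfolding order_mean_def by (intro divide_nonneg_nonneg sum_nonneg) auto
    moreover have "1 + a \<le> exp a" by (rule exp_ge_add_one_self)
    ultimately show "0 \<le> order_mean (B j) (?f j) \<and> order_mean (B j) (?f j) \<le> exp a"
      using a[OF j] mean by linarith
  qed
  also have "exp (- k) * (\<Prod>j\<in>J. exp a) = exp (a * card J - k)"
    by (simp add: exp_of_nat_mult[symmetric] exp_add[symmetric] exp_diff mult.commute exp_minus field_simps)
  finally show ?thesis by simp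
qed

text \<open>The choice \<open>s = t / 4\<close> gains \<open>t\<^sup>2 / 4 * N\<close> from the
  deviation and loses at most \<open>s\<^sup>2 * N = t\<^sup>2 / 16 * N\<close> to the second-order
  term of \<open>exp s - 1\<close>. The deviation is measured against \<open>N\<close> instead of
  \<open>card J\<close>, so that small colour classes get the same error bound as large
  ones.\<close>

lemma order_prob_upper_tail:
  fixes p t N :: real
  assumes "finite J" "finite V" "\<And>j. j \<in> J \<Longrightarrow> B j \<subseteq> V" "disjoint_family_on B J"
    and p: "\<And>j. j \<in> J \<Longrightarrow> order_prob (B j) (P j) \<le> p" "0 \<le> p" "p \<le> 1"
    and t: "0 < t" "t \<le> 1" and N: "card J \<le> N"
  shows "order_prob V (\<lambda>\<pi>. p * card J + t * N \<le> card {j \<in> J. P j (filter (\<lambda>x. x \<in> B j) \<pi>)})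
    \<le> exp (- (t\<^sup>2 / 8) * N)"
proof -
  define s where "s = t / 4"
  have s: "0 < s" "s \<le> 1" using t by (auto simp: s_def)
  have es: "0 \<le> exp s - 1" "exp s - 1 \<le> s + s\<^sup>2" using exp_bound[of s] s by auto
  have "(exp s - 1) * order_prob (B j) (P j) \<le> (s + s\<^sup>2) * p" if "j \<in> J" for j
    using es p that
    by (meson mult_left_mono mult_right_mono order_trans)
  then have "order_prob V (\<lambda>\<pi>. s * (p * card J + t * N)
        \<le> s * card {j \<in> J. P j (filter (\<lambda>x. x \<in> B j) \<pi>)})
      \<le> exp ((s + s\<^sup>2) * p * card J - s * (p * card J + t * N))"
    using assms(1-4) by (intro order_prob_count_ge) auto
  moreover have "(s + s\<^sup>2) * p * card J - s * (p * card J + t * N) \<le> - (t\<^sup>2 / 8) * N"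
  proof -
    have "p * card J \<le> 1 * N" using p N by (intro mult_mono) auto
    then have "s\<^sup>2 * (p * card J) \<le> s\<^sup>2 * N" by (intro mult_left_mono) auto
    moreover have "0 \<le> t\<^sup>2 * N" using N by (intro mult_nonneg_nonneg) auto
    ultimately show ?thesis by (simp add: s_def power2_eq_square algebra_simps)
  qed
  ultimately have "order_prob V (\<lambda>\<pi>. s * (p * card J + t * N)
        \<le> s * card {j \<in> J. P j (filter (\<lambda>x. x \<in> B j) \<pi>)}) \<le> exp (- (t\<^sup>2 / 8) * N)"
    by (meson exp_le_cancel_iff order_trans)
  then show ?thesis using s by simp
qed

text \<open>Here \<open>s = -1\<close>. Since \<open>exp (-1) - 1 \<le> - (1/2)\<close>, the moment
  bound has exponent \<open>- (p / 2) * card J\<close>, and the threshold gives back half of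
  it.\<close>

lemma order_prob_lower_tail:
  fixes p :: real
  assumes "finite J" "finite V" "\<And>j. j \<in> J \<Longrightarrow> B j \<subseteq> V" "disjoint_family_on B J"
    and p: "\<And>j. j \<in> J \<Longrightarrow> p \<le> order_prob (B j) (P j)" "0 \<le> p"
  shows "order_prob V (\<lambda>\<pi>. card {j \<in> J. P j (filter (\<lambda>x. x \<in> B j) \<pi>)} \<le> p * card J / 4)
    \<le> exp (- (p * card J / 4))"
proof -
  have "exp (-1) \<le> (1/2 :: real)"
    using exp_ge_add_one_self[of "1::real"] by (simp add: exp_minus field_simps)
  then have "(exp (-1) - 1) * order_prob (B j) (P j) \<le> - (p / 2)" if "j \<in> J" for j
    using p(1)[OF that] p(2) mult_right_mono[of "exp (-1) - 1" "- (1/2)" "order_prob (B j) (P j)"]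
    by simp
  then have "order_prob V (\<lambda>\<pi>. - (p * card J / 4)
        \<le> (-1) * real (card {j \<in> J. P j (filter (\<lambda>x. x \<in> B j) \<pi>)}))
      \<le> exp (- (p / 2) * card J - - (p * card J / 4))"
    using assms(1-4) by (intro order_prob_count_ge) auto
  also have "- (p / 2) * card J - - (p * card J / 4) = - (p * card J / 4)" by simp
  finally show ?thesis by simp
qed

section \<open>Events in a single ball, and classes of vertices with disjoint balls\<close>

lemma order_prob_last_le:
  assumes "finite B" "v \<in> B"
  shows "order_prob B (\<lambda>\<pi>. \<forall>u\<in>B - {v}. precedes \<pi> u v) \<le> 1 / card B"
proof -
  have sub: "{\<pi> \<in> permutations_of_set B. \<forall>u\<in>B - {v}. precedes \<pi> u v}
      \<subseteq> (\<lambda>\<rho>. \<rho> @ [v]) ` permutations_of_set (B - {v})"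
  proof
    fix \<pi> assume \<pi>: "\<pi> \<in> {\<pi> \<in> permutations_of_set B. \<forall>u\<in>B - {v}. precedes \<pi> u v}"
    then have set: "set \<pi> = B" "distinct \<pi>" by (auto dest: permutations_of_setD)
    then obtain \<rho> w where w: "\<pi> = \<rho> @ [w]" using assms(2) by (cases \<pi> rule: rev_cases) auto
    have "w = v"
    proof (rule ccontr)
      assume "w \<noteq> v"
      then have "precedes \<pi> w v" using \<pi> set w by auto
      then show False using set w \<open>w \<noteq> v\<close>
        by (auto simp: precedes_append precedes_Cons dest: precedes_in_set)
    qed
    moreover have "\<rho> \<in> permutations_of_set (B - {v})"
      using set w \<open>w = v\<close> by (intro permutations_of_setI) auto
    ultimately show "\<pi> \<in> (\<lambda>\<rho>. \<rho> @ [v]) ` permutations_of_set (B - {v})" using w by blast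
  qed
  have "card {\<pi> \<in> permutations_of_set B. \<forall>u\<in>B - {v}. precedes \<pi> u v} \<le> fact (card B - 1)"
    using card_mono[OF _ sub] assms by (simp add: card_image inj_on_def)
  then have "real (card {\<pi> \<in> permutations_of_set B. \<forall>u\<in>B - {v}. precedes \<pi> u v})
      \<le> real (fact (card B - 1))"
    by (rule of_nat_mono)
  then have "order_prob B (\<lambda>\<pi>. \<forall>u\<in>B - {v}. precedes \<pi> u v) \<le> fact (card B - 1) / fact (card B)"
    unfolding order_prob_eq_card of_nat_fact by (rule divide_right_mono) simp
  moreover have "card B > 0" using assms by (auto simp: card_gt_0_iff)
  ultimately show ?thesis
    using fact_reduce[of "card B", where 'a = real] by (simp add: field_simps)
qed

text \<open>One favourable ordering is exhibited. For balls of bounded size this crude bound is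
  still a positive constant.\<close>

lemma order_prob_last_block_ge:
  assumes "finite B" "A \<subseteq> B"
  shows "1 / fact (card B) \<le> order_prob B (\<lambda>\<pi>. \<forall>u\<in>A. \<forall>w\<in>B - A. precedes \<pi> w u)"
proof -
  obtain xs ys where xs: "set xs = B - A" "distinct xs" and ys: "set ys = A" "distinct ys"
    using finite_distinct_list assms finite_subset by (metis finite_Diff)
  have "xs @ ys \<in> {\<pi> \<in> permutations_of_set B. \<forall>u\<in>A. \<forall>w\<in>B - A. precedes \<pi> w u}"
    using xs ys assms(2) by (auto simp: precedes_append intro!: permutations_of_setI)
  then have "card {\<pi> \<in> permutations_of_set B. \<forall>u\<in>A. \<forall>w\<in>B - A. precedes \<pi> w u} > 0"
    by (auto simp: card_gt_0_iff)
  then show ?thesis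
    unfolding order_prob_eq_card by (intro divide_right_mono) auto
qed

text \<open>Greedy colouring: a new vertex has fewer than \<open>k\<close> coloured neighbours under
  \<open>R\<close>, so one of the \<open>k\<close> colours is free.\<close>

lemma exists_proper_colouring:
  assumes "finite V" "\<And>v. v \<in> V \<Longrightarrow> card {u \<in> V. u \<noteq> v \<and> R u v} < k" "symp R"
  shows "\<exists>col. (\<forall>v\<in>V. col v < k) \<and> (\<forall>u\<in>V. \<forall>v\<in>V. u \<noteq> v \<longrightarrow> R u v \<longrightarrow> col u \<noteq> (col v :: nat))"
  using assms(1,2)
proof (induction V rule: finite_induct)
  case empty
  then show ?case by simp
next
  case (insert x V)
  have deg: "card {u \<in> V. u \<noteq> v \<and> R u v} < k" if "v \<in> V" for v
  proof -
    have "card {u \<in> V. u \<noteq> v \<and> R u v} \<le> card {u \<in> insert x V. u \<noteq> v \<and> R u v}"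
      using insert.hyps(1) by (intro card_mono) auto
    then show ?thesis using insert.prems[of v] that by simp
  qed
  obtain col where col: "\<forall>v\<in>V. col v < k"
    "\<forall>u\<in>V. \<forall>v\<in>V. u \<noteq> v \<longrightarrow> R u v \<longrightarrow> col u \<noteq> (col v :: nat)"
    using insert.IH[OF deg] by auto
  let ?N = "{u \<in> insert x V. u \<noteq> x \<and> R u x}"
  have "card (col ` ?N) < k"
    using card_image_le[of ?N col] insert.prems[of x] insert.hyps(1) by auto
  then have "\<not> {..<k} \<subseteq> col ` ?N"
    using card_mono[of "col ` ?N" "{..<k}"] insert.hyps(1) by auto
  then obtain c where c: "c < k" "c \<notin> col ` ?N" by auto
  then have new: "col u \<noteq> c" if "u \<in> V" "R u x \<or> R x u" for u
    using that insert.hyps(2) sympD[OF assms(3)] by blast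
  then show ?case
    using col c(1) insert.hyps(2) new
    by (intro exI[of _ "col(x := c)"]) auto
qed

text \<open>By symmetry, a ball that meets \<open>B v\<close> has its centre in the ball of some
  member of \<open>B v\<close>. There are at most \<open>b * b\<close> such centres, and
  \<open>v\<close> itself is one of them, so fewer than \<open>b * b\<close> other vertices conflict
  with \<open>v\<close>.\<close>

lemma disjoint_balls_colouring:
  fixes B :: "'a \<Rightarrow> 'a set"
  assumes "finite V" "\<And>v. v \<in> V \<Longrightarrow> B v \<subseteq> V" "\<And>v. v \<in> V \<Longrightarrow> v \<in> B v"
    and sym: "\<And>u v. u \<in> V \<Longrightarrow> v \<in> V \<Longrightarrow> u \<in> B v \<Longrightarrow> v \<in> B u"
    and card: "\<And>v. v \<in> V \<Longrightarrow> card (B v) \<le> b"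
  shows "\<exists>col. (\<forall>v\<in>V. col v < b * b) \<and> (\<forall>i :: nat. disjoint_family_on B {v \<in> V. col v = i})"
proof -
  let ?R = "\<lambda>u v. B u \<inter> B v \<noteq> {}"
  have deg: "card {u \<in> V. u \<noteq> v \<and> ?R u v} < b * b" if v: "v \<in> V" for v
  proof -
    have sub: "{u \<in> V. u \<noteq> v \<and> ?R u v} \<subseteq> (\<Union>x\<in>B v. B x) - {v}"
    proof
      fix u assume u: "u \<in> {u \<in> V. u \<noteq> v \<and> ?R u v}"
      then obtain x where x: "x \<in> B u" "x \<in> B v" by blast
      then have "u \<in> B x" using sym[of x u] assms(2)[of u] u by blast
      then show "u \<in> (\<Union>x\<in>B v. B x) - {v}" using x(2) u by blast
    qed
    have finB: "finite (B x)" if "x \<in> V" for x using assms(1,2) that finite_subset by blast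
    have fin: "finite (\<Union>x\<in>B v. B x)" using assms(2)[OF v] finB v by (intro finite_UN_I) auto
    have vin: "v \<in> (\<Union>x\<in>B v. B x)" using assms(3) v by blast
    have "card (\<Union>x\<in>B v. B x) \<le> (\<Sum>x\<in>B v. card (B x))" by (rule card_UN_le[OF finB[OF v]])
    also have "\<dots> \<le> card (B v) * b"
      using sum_bounded_above[of "B v" "\<lambda>x. card (B x)" b] card assms(2)[OF v] by auto
    also have "\<dots> \<le> b * b" using card[OF v] by simp
    finally have "card (\<Union>x\<in>B v. B x) \<le> b * b" .
    moreover have "card ((\<Union>x\<in>B v. B x) - {v}) < card (\<Union>x\<in>B v. B x)"
      using fin vin by (intro psubset_card_mono) auto
    moreover have "card {u \<in> V. u \<noteq> v \<and> ?R u v} \<le> card ((\<Union>x\<in>B v. B x) - {v})"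
      using fin by (intro card_mono sub) auto
    ultimately show ?thesis by linarith
  qed
  have symp: "symp ?R" by (auto simp: symp_def)
  have "\<exists>col. (\<forall>v\<in>V. col v < b * b) \<and> (\<forall>u\<in>V. \<forall>v\<in>V. u \<noteq> v \<longrightarrow> ?R u v \<longrightarrow> col u \<noteq> (col v :: nat))"
    by (rule exists_proper_colouring[OF assms(1) deg symp])
  then obtain col where col: "\<forall>v\<in>V. col v < b * b"
    "\<forall>u\<in>V. \<forall>v\<in>V. u \<noteq> v \<longrightarrow> ?R u v \<longrightarrow> col u \<noteq> (col v :: nat)"
    by auto
  have "disjoint_family_on B {v \<in> V. col v = i}" for i
    unfolding disjoint_family_on_def
  proof (intro ballI impI)
    fix u v assume "u \<in> {v \<in> V. col v = i}" "v \<in> {v \<in> V. col v = i}" "u \<noteq> v"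
    then show "B u \<inter> B v = {}" using col(2)[rule_format, of u v] by auto
  qed
  then show ?thesis using col(1) by blast
qed

section \<open>The cycle plus a matching\<close>

definition cycle_nbrs :: "nat \<Rightarrow> nat \<Rightarrow> nat set" where
  "cycle_nbrs n v = {u. {u, v} \<in> cycle_edges n}"

text \<open>Pairs at distance at most 2 on the cycle; the empty set and singletons also belong to
  \<open>short_pairs\<close>, but to no matching.\<close>

definition short_pairs :: "nat \<Rightarrow> nat set set" where
  "short_pairs n = (\<Union>c<n. Pow (insert c (cycle_nbrs n c)))"

text \<open>Intervals are counted on the path \<open>0, \<dots>, n - 1\<close>, so one that wraps around the cycle counts twice.\<close>

definition segments :: "nat set \<Rightarrow> nat" where
  "segments U = card {x \<in> U. x = 0 \<or> x - 1 \<notin> U}"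

lemma cycle_edges_iff:
  "{u, v} \<in> cycle_edges n \<longleftrightarrow> u < n \<and> v < n \<and> (u = (v + 1) mod n \<or> v = (u + 1) mod n)"
  unfolding cycle_edges_def by (auto simp: doubleton_eq_iff)

lemma cycle_nbrs_eq:
  assumes "v < n"
  shows "cycle_nbrs n v = {if v + 1 = n then 0 else v + 1, if v = 0 then n - 1 else v - 1}"
proof (rule set_eqI)
  fix u
  show "u \<in> cycle_nbrs n v \<longleftrightarrow> u \<in> {if v + 1 = n then 0 else v + 1, if v = 0 then n - 1 else v - 1}"
  proof (cases "u < n")
    case True
    then show ?thesis
      using assms by (auto simp: cycle_nbrs_def cycle_edges_iff mod_Suc split: if_splits)
  next
    case False
    then show ?thesis
      using assms by (auto simp: cycle_nbrs_def cycle_edges_iff split: if_splits)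
  qed
qed

lemma cycle_nbrs_sym: "u \<in> cycle_nbrs n v \<longleftrightarrow> v \<in> cycle_nbrs n u"
  by (simp add: cycle_nbrs_def insert_commute)

lemma cycle_nbrs_less: "u \<in> cycle_nbrs n v \<Longrightarrow> u < n \<and> v < n"
  by (simp add: cycle_nbrs_def cycle_edges_iff)

lemma card_cycle_nbrs: "3 < n \<Longrightarrow> v < n \<Longrightarrow> card (cycle_nbrs n v) = 2"
  by (auto simp: cycle_nbrs_eq card_insert_if)

lemma cycle_nbrs_irrefl: "3 < n \<Longrightarrow> v \<notin> cycle_nbrs n v"
  by (cases "v < n") (auto simp: cycle_nbrs_eq dest: cycle_nbrs_less split: if_splits)

lemma cycle_nbrs_triangle_free:
  assumes "3 < n" "u \<in> cycle_nbrs n v" "w \<in> cycle_nbrs n v"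
  shows "u \<notin> cycle_nbrs n w"
proof -
  have "v < n" "u < n" "w < n" using assms cycle_nbrs_less by blast+
  then show ?thesis using assms by (auto simp: cycle_nbrs_eq split: if_splits)
qed

lemma finite_cycle_nbrs [simp]: "finite (cycle_nbrs n v)"
  by (rule finite_subset[of _ "{..<n}"]) (auto dest: cycle_nbrs_less)

lemma finite_short_pairs [simp]: "finite (short_pairs n)"
  by (simp add: short_pairs_def)

text \<open>A closed neighbourhood on the cycle has three points, hence eight subsets.\<close>

lemma card_short_pairs: "3 < n \<Longrightarrow> card (short_pairs n) \<le> 8 * n"
proof -
  assume n: "3 < n"
  have "card (short_pairs n) \<le> (\<Sum>c<n. card (Pow (insert c (cycle_nbrs n c))))"
    unfolding short_pairs_def by (rule card_UN_le) simp
  also have "\<dots> = (\<Sum>c<n. 8)"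
    using n by (intro sum.cong) (auto simp: card_Pow card_insert_if card_cycle_nbrs cycle_nbrs_irrefl)
  finally show ?thesis by simp
qed

section \<open>Degrees, triangles and edge counts in the cycle plus a fixed matching\<close>

locale cycle_plus_matching =
  fixes n :: nat and M :: "nat set set"
  assumes n_gt_3: "3 < n" and matching: "M \<in> perfect_matchings {..<n}"
begin

definition nbrs :: "nat \<Rightarrow> nat set" where
  "nbrs v = {u \<in> {..<n}. {u, v} \<in> cycle_edges n \<union> M}"

definition partner :: "nat \<Rightarrow> nat" where
  "partner v = (THE u. {u, v} \<in> M)"

text \<open>The disjointness condition only excludes triangles through \<open>v\<close>. Cycles of
  length 4 are allowed, so the ball of radius 2 need not be a tree.\<close>

definition tree_like :: "nat \<Rightarrow> bool" where
  "tree_like v \<longleftrightarrow> card (nbrs v) = 3 \<and> (\<forall>u\<in>nbrs v. card (nbrs u) = 3 \<and> nbrs u \<inter> nbrs v = {})"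

lemma matching_edge: "e \<in> M \<Longrightarrow> e \<subseteq> {..<n}" "e \<in> M \<Longrightarrow> card e = 2"
  using matching by (auto simp: perfect_matchings_def)

lemma matching_unique: "e \<in> M \<Longrightarrow> f \<in> M \<Longrightarrow> v \<in> e \<Longrightarrow> v \<in> f \<Longrightarrow> e = f"
  using matching matching_edge(1)[of e] unfolding perfect_matchings_def by blast

lemma partner_unique: "{u, v} \<in> M \<Longrightarrow> {w, v} \<in> M \<Longrightarrow> u = w"
  using matching_unique[of "{u, v}" "{w, v}" v] by (auto simp: doubleton_eq_iff)

lemma partner_iff:
  assumes "v < n"
  shows "{u, v} \<in> M \<longleftrightarrow> u = partner v"
proof -
  obtain e where e: "e \<in> M" "v \<in> e"
    using matching assms unfolding perfect_matchings_def by blast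
  then obtain w where "e = {w, v}"
    using matching_edge(2)[OF e(1)] by (auto simp: card_2_iff)
  then have "{w, v} \<in> M" using e(1) by simp
  then have "\<exists>!u. {u, v} \<in> M" using partner_unique by blast
  then show ?thesis unfolding partner_def by (metis (mono_tags, lifting) theI')
qed

lemma partner_less: "v < n \<Longrightarrow> partner v < n" "v < n \<Longrightarrow> partner v \<noteq> v"
  using partner_iff[of v "partner v"] matching_edge[of "{partner v, v}"] by (auto simp: card_insert_if)

lemma nbrs_eq: "v < n \<Longrightarrow> nbrs v = insert (partner v) (cycle_nbrs n v)"
  using partner_less(1)[of v] partner_iff[of v]
  by (auto simp: nbrs_def cycle_nbrs_def cycle_edges_iff)

lemma nbrs_sym: "u < n \<Longrightarrow> v < n \<Longrightarrow> u \<in> nbrs v \<longleftrightarrow> v \<in> nbrs u"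
  by (simp add: nbrs_def insert_commute)

lemma nbrs_less: "u \<in> nbrs v \<Longrightarrow> u < n"
  by (simp add: nbrs_def)

lemma nbrs_irrefl: "v < n \<Longrightarrow> v \<notin> nbrs v"
  using partner_less(2)[of v] cycle_nbrs_irrefl[OF n_gt_3, of v] by (auto simp: nbrs_eq)

lemma finite_nbrs [simp]: "finite (nbrs v)"
  by (simp add: nbrs_def)

lemma card_nbrs_le: "v < n \<Longrightarrow> card (nbrs v) \<le> 3"
  using n_gt_3 by (simp add: nbrs_eq card_insert_if card_cycle_nbrs)

lemma card_nbrs_ge: "v < n \<Longrightarrow> 2 \<le> card (nbrs v)"
  using n_gt_3 by (simp add: nbrs_eq card_insert_if card_cycle_nbrs)

text \<open>The degree drops to 2 only if the partner is also a cycle neighbour, that is, if the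
  matching edge repeats a cycle edge.\<close>

lemma short_edge_of_deficient:
  assumes "v < n" "card (nbrs v) \<noteq> 3"
  shows "\<exists>e\<in>M \<inter> short_pairs n. v \<in> e"
proof -
  have "partner v \<in> cycle_nbrs n v"
    using assms n_gt_3 by (auto simp: nbrs_eq card_insert_if card_cycle_nbrs split: if_splits)
  then have "{partner v, v} \<in> short_pairs n" using assms(1) by (auto simp: short_pairs_def)
  then show ?thesis using partner_iff[OF assms(1), of "partner v"] by blast
qed

text \<open>Matching edges share no endpoints, and the cycle has no triangle because
  \<open>3 < n\<close>. So exactly one side of a triangle is a matching edge, and the other two
  sides make its ends cycle neighbours of the third vertex.\<close>

lemma short_edge_of_triangle:
  assumes "v < n" "u \<in> nbrs v" "w \<in> nbrs v" "w \<in> nbrs u"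
  shows "\<exists>e\<in>M \<inter> short_pairs n. \<exists>x\<in>e. v \<in> insert x (nbrs x)"
proof -
  have lt: "u < n" "w < n" using assms(2,3) nbrs_less by auto
  have irr: "u \<noteq> v" "w \<noteq> v" "w \<noteq> u" using assms nbrs_irrefl lt by auto
  have sym: "v \<in> nbrs u" "v \<in> nbrs w" using assms nbrs_sym lt by blast+
  have short: ?thesis if "{x, y} \<in> M" "x \<in> cycle_nbrs n c" "y \<in> cycle_nbrs n c"
      "v \<in> insert x (nbrs x)" for x y c
    using that cycle_nbrs_less[OF that(2)] by (intro bexI[of _ "{x, y}"]) (auto simp: short_pairs_def)
  have cyc_or: "b \<in> cycle_nbrs n a \<or> {b, a} \<in> M" if "b \<in> nbrs a" for a b
    using that by (auto simp: nbrs_def cycle_nbrs_def)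
  have comm: "{b, a} = {a, b}" for a b :: nat by auto
  consider "{u, v} \<in> M" | "{w, v} \<in> M" | "{w, u} \<in> M"
    | "u \<in> cycle_nbrs n v" "w \<in> cycle_nbrs n v" "w \<in> cycle_nbrs n u"
    using cyc_or assms(2-4) by blast
  then show ?thesis
  proof cases
    case 1
    have "w \<in> cycle_nbrs n v" "w \<in> cycle_nbrs n u"
      using cyc_or[OF assms(3)] cyc_or[OF assms(4)] 1 partner_unique irr comm by metis+
    then show ?thesis using short[of u v w] 1 sym cycle_nbrs_sym by blast
  next
    case 2
    have "u \<in> cycle_nbrs n v" "w \<in> cycle_nbrs n u"
      using cyc_or[OF assms(2)] cyc_or[OF assms(4)] 2 partner_unique irr comm by metis+
    then show ?thesis using short[of w v u] 2 sym cycle_nbrs_sym by blast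
  next
    case 3
    have "u \<in> cycle_nbrs n v" "w \<in> cycle_nbrs n v"
      using cyc_or[OF assms(2)] cyc_or[OF assms(3)] 3 partner_unique irr comm by metis+
    then show ?thesis using short[of w u v] 3 sym by blast
  next
    case 4
    then show ?thesis using cycle_nbrs_triangle_free[OF n_gt_3] by blast
  qed
qed

text \<open>Each failure lies within distance 1 of an end of a short matching edge. There are two
  ends, and a closed neighbourhood has at most four vertices.\<close>

lemma card_not_tree_like: "card {v \<in> {..<n}. \<not> tree_like v} \<le> 8 * card (M \<inter> short_pairs n)"
proof -
  let ?F = "M \<inter> short_pairs n"
  have sub: "{v \<in> {..<n}. \<not> tree_like v} \<subseteq> (\<Union>e\<in>?F. \<Union>x\<in>e. insert x (nbrs x))"
  proof
    fix v assume "v \<in> {v \<in> {..<n}. \<not> tree_like v}"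
    then have v: "v < n" "\<not> tree_like v" by auto
    then consider "card (nbrs v) \<noteq> 3" | u where "u \<in> nbrs v" "card (nbrs u) \<noteq> 3"
      | u w where "u \<in> nbrs v" "w \<in> nbrs v" "w \<in> nbrs u"
      unfolding tree_like_def by blast
    then have "\<exists>e\<in>?F. \<exists>x\<in>e. v \<in> insert x (nbrs x)"
    proof cases
      case 1
      then show ?thesis using short_edge_of_deficient[OF v(1)] by blast
    next
      case 2
      then show ?thesis
        using short_edge_of_deficient[OF nbrs_less[OF 2(1)] 2(2)] nbrs_sym[OF nbrs_less[OF 2(1)] v(1)]
        by blast
    next
      case 3
      then show ?thesis using short_edge_of_triangle[OF v(1)] by blast
    qed
    then show "v \<in> (\<Union>e\<in>?F. \<Union>x\<in>e. insert x (nbrs x))" by blast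
  qed
  have fin: "finite e" if "e \<in> ?F" for e using matching_edge(1)[of e] that finite_subset by auto
  have "card {v \<in> {..<n}. \<not> tree_like v} \<le> card (\<Union>e\<in>?F. \<Union>x\<in>e. insert x (nbrs x))"
    using fin by (intro card_mono sub) auto
  also have "\<dots> \<le> (\<Sum>e\<in>?F. card (\<Union>x\<in>e. insert x (nbrs x)))"
    by (rule card_UN_le) simp
  also have "\<dots> \<le> (\<Sum>e\<in>?F. 8)"
  proof (rule sum_mono)
    fix e assume e: "e \<in> ?F"
    have "card (\<Union>x\<in>e. insert x (nbrs x)) \<le> (\<Sum>x\<in>e. card (insert x (nbrs x)))"
      by (rule card_UN_le[OF fin[OF e]])
    also have "\<dots> \<le> (\<Sum>x\<in>e. 4)"
    proof (rule sum_mono)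
      fix x assume "x \<in> e"
      then have "x < n" using matching_edge(1)[of e] e by auto
      then show "card (insert x (nbrs x)) \<le> 4"
        using card_nbrs_le[of x] by (simp add: card_insert_if)
    qed
    also have "\<dots> = 8" using matching_edge(2)[of e] e by simp
    finally show "card (\<Union>x\<in>e. insert x (nbrs x)) \<le> 8" .
  qed
  finally show ?thesis by simp
qed

text \<open>Over all vertices, the sum of degree minus 2 is at least the number of tree-like
  vertices. Deleting a vertex removes its own excess, at most 1, and at most 3 edge ends in
  \<open>S\<close>, hence the factor 4. When a quarter of the vertices is deleted, the main terms
  cancel.\<close>

lemma sum_excess_ge:
  assumes "S \<subseteq> {..<n}"
  shows "(\<Sum>v\<in>S. real (card (nbrs v \<inter> S)) - 2)
    \<ge> real n - 8 * card (M \<inter> short_pairs n) - 4 * card ({..<n} - S)"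
proof -
  let ?D = "{..<n} - S"
  have fin: "finite S" using assms finite_subset by blast
  have split: "card (nbrs v) = card (nbrs v \<inter> S) + card (nbrs v \<inter> ?D)" for v
  proof -
    have "nbrs v = (nbrs v \<inter> S) \<union> (nbrs v \<inter> ?D)" by (auto dest: nbrs_less)
    then show ?thesis by (metis Diff_disjoint Int_assoc card_Un_disjoint finite_Int finite_nbrs inf_bot_right inf_commute)
  qed
  have count: "real (card (nbrs v \<inter> A)) = (\<Sum>u\<in>A. of_bool (u \<in> nbrs v))" if "finite A" for v A
    using that by (simp add: Int_commute)
  \<comment> \<open>The edges between \<open>S\<close> and its complement are counted from both
    sides.\<close>
  have "(\<Sum>v\<in>S. real (card (nbrs v \<inter> ?D))) = (\<Sum>v\<in>S. \<Sum>u\<in>?D. of_bool (u \<in> nbrs v))"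
    using count by simp
  also have "\<dots> = (\<Sum>u\<in>?D. \<Sum>v\<in>S. of_bool (v \<in> nbrs u))"
    unfolding sum.swap[of _ S] using assms nbrs_sym by (intro sum.cong refl) auto
  also have "\<dots> = (\<Sum>u\<in>?D. real (card (nbrs u \<inter> S)))"
    using count[OF fin] by simp
  also have "\<dots> \<le> (\<Sum>u\<in>?D. real (card (nbrs u)))"
    by (intro sum_mono of_nat_mono card_mono) auto
  also have "\<dots> \<le> (\<Sum>u\<in>?D. 3)"
    using card_nbrs_le by (intro sum_mono) (auto simp: numeral_le_real_of_nat_iff)
  finally have cut: "(\<Sum>v\<in>S. real (card (nbrs v \<inter> ?D))) \<le> 3 * real (card ?D)" by simp
  have D3: "(\<Sum>v\<in>?D. real (card (nbrs v)) - 2) \<le> (\<Sum>v\<in>?D. 1)"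
    using card_nbrs_le by (intro sum_mono) force
  have "real n - 8 * card (M \<inter> short_pairs n) \<le> real (card {v \<in> {..<n}. tree_like v})"
  proof -
    have "{..<n} = {v \<in> {..<n}. tree_like v} \<union> {v \<in> {..<n}. \<not> tree_like v}" by auto
    then have "n \<le> card {v \<in> {..<n}. tree_like v} + card {v \<in> {..<n}. \<not> tree_like v}"
      by (metis card_Un_le card_lessThan)
    then show ?thesis using card_not_tree_like by linarith
  qed
  also have "\<dots> = (\<Sum>v<n. of_bool (tree_like v))"
    by (simp add: Int_def)
  also have "\<dots> \<le> (\<Sum>v<n. real (card (nbrs v)) - 2)"
    using card_nbrs_ge by (intro sum_mono) (force simp: tree_like_def)
  also have "\<dots> = (\<Sum>v\<in>S. real (card (nbrs v)) - 2) + (\<Sum>v\<in>?D. real (card (nbrs v)) - 2)"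
    using assms by (intro sum.subset_diff[of S "{..<n}", THEN trans]) auto
  also have "(\<Sum>v\<in>S. real (card (nbrs v)) - 2)
      = (\<Sum>v\<in>S. real (card (nbrs v \<inter> S)) - 2) + (\<Sum>v\<in>S. real (card (nbrs v \<inter> ?D)))"
    unfolding split by (simp add: sum.distrib sum_subtractf)
  finally show ?thesis using cut D3 by simp
qed

text \<open>The degree sum is twice the number of edges inside \<open>U\<close>. The path
  contributes \<open>card U - segments U\<close> edges and the closing edge at most one, whence the
  summand 2; the other edges belong to the matching.\<close>

lemma sum_card_nbrs_le:
  assumes "U \<subseteq> {..<n}"
  shows "(\<Sum>v\<in>U. card (nbrs v \<inter> U)) + 2 * segments U \<le> 2 * card U + 2 + 2 * card (M \<inter> Pow U)"
proof -
  have fin: "finite U" using assms finite_subset by blast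
  \<comment> \<open>The guard \<open>0 < v\<close> keeps the value \<open>0 - 1 = 0\<close> from
    counting as a neighbour. Shifting by one maps \<open>?down\<close> onto \<open>?up\<close>; both
    count the path edges inside \<open>U\<close>.\<close>
  let ?down = "{v \<in> U. 0 < v \<and> v - 1 \<in> U}" and ?up = "{v \<in> U. v + 1 \<in> U}"
  \<comment> \<open>The indicators of \<open>v = 0\<close> and \<open>v = n - 1\<close> pay for the
    closing edge \<open>{n - 1, 0}\<close>.\<close>
  have nb: "card (nbrs v \<inter> U) \<le> of_bool (v + 1 \<in> U) + of_bool (0 < v \<and> v - 1 \<in> U)
      + of_bool (v = 0) + of_bool (v = n - 1) + of_bool (partner v \<in> U)" if "v \<in> U" for v
  proof -
    have v: "v < n" using that assms by auto
    have "nbrs v \<inter> U \<subseteq> (if v + 1 \<in> U then {v + 1} else {}) \<union> (if 0 < v \<and> v - 1 \<in> U then {v - 1} else {})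
      \<union> (if v = 0 then {n - 1} else {}) \<union> (if v = n - 1 then {0} else {})
      \<union> (if partner v \<in> U then {partner v} else {})"
      using v by (auto simp: nbrs_eq cycle_nbrs_eq split: if_splits)
    then have "card (nbrs v \<inter> U) \<le> card \<dots>" by (intro card_mono) auto
    also have "\<dots> \<le> of_bool (v + 1 \<in> U) + of_bool (0 < v \<and> v - 1 \<in> U)
      + of_bool (v = 0) + of_bool (v = n - 1) + of_bool (partner v \<in> U)"
      by (intro card_Un_le[THEN order_trans] add_mono) auto
    finally show ?thesis .
  qed
  have "?up = (\<lambda>v. v - 1) ` ?down"
    by (force simp: image_iff intro: bexI[of _ "Suc _"])
  then have "card ?up \<le> card ?down" using fin by (simp add: card_image_le)
  moreover have "card U = card ?down + segments U"
  proof -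
    have "U = ?down \<union> {x \<in> U. x = 0 \<or> x - 1 \<notin> U}" by auto
    moreover have "card (?down \<union> {x \<in> U. x = 0 \<or> x - 1 \<notin> U}) = card ?down + segments U"
      unfolding segments_def using fin by (intro card_Un_disjoint) auto
    ultimately show ?thesis by simp
  qed
  moreover have "card {v \<in> U. partner v \<in> U} \<le> 2 * card (M \<inter> Pow U)"
  proof -
    have finM: "finite (M \<inter> Pow U)" using fin by simp
    have "{v \<in> U. partner v \<in> U} \<subseteq> \<Union>(M \<inter> Pow U)"
    proof
      fix v assume v: "v \<in> {v \<in> U. partner v \<in> U}"
      then have "{partner v, v} \<in> M" using partner_iff[of v "partner v"] assms by auto
      then show "v \<in> \<Union>(M \<inter> Pow U)" using v by auto
    qed
    then have "card {v \<in> U. partner v \<in> U} \<le> card (\<Union>(M \<inter> Pow U))"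
      using fin finM by (intro card_mono finite_Union) (auto intro: finite_subset)
    also have "\<dots> \<le> (\<Sum>e\<in>M \<inter> Pow U. card e)" by (rule card_Union_le_sum_card)
    also have "\<dots> = 2 * card (M \<inter> Pow U)" using matching_edge(2) by simp
    finally show ?thesis .
  qed
  moreover have "(\<Sum>v\<in>U. card (nbrs v \<inter> U)) \<le> card ?up + card ?down + 1 + 1 + card {v \<in> U. partner v \<in> U}"
  proof -
    have one: "(\<Sum>v\<in>U. of_bool (v = a)) \<le> (1 :: nat)" for a
      using fin by (simp add: of_bool_def)
    have "(\<Sum>v\<in>U. card (nbrs v \<inter> U)) \<le> (\<Sum>v\<in>U. of_bool (v + 1 \<in> U)
      + of_bool (0 < v \<and> v - 1 \<in> U) + of_bool (v = 0) + of_bool (v = n - 1) + of_bool (partner v \<in> U))"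
      using nb by (rule sum_mono)
    also have "\<dots> = card ?up + card ?down + (\<Sum>v\<in>U. of_bool (v = 0)) + (\<Sum>v\<in>U. of_bool (v = n - 1))
        + card {v \<in> U. partner v \<in> U}"
      unfolding sum.distrib using fin by (simp add: Int_def)
    finally show ?thesis using one[of 0] one[of "n - 1"] by linarith
  qed
  ultimately show ?thesis by linarith
qed

end

section \<open>Unions of dense components\<close>

definition connected_rel :: "'a set \<Rightarrow> 'a set set \<Rightarrow> ('a \<times> 'a) set" where
  "connected_rel S E = {(u, v) \<in> S \<times> S. (u, v) \<in> {(x, y). {x, y} \<in> induced_edges E S}\<^sup>*}"

lemma connected_components_eq: "connected_components S (induced_edges E S) = S // connected_rel S E"
  by (simp add: connected_components_def connected_rel_def)

lemma equiv_connected_rel: "equiv S (connected_rel S E)"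
proof (rule equivI)
  have "sym {(x, y). {x, y} \<in> induced_edges E S}" by (auto simp: sym_def insert_commute)
  then have "sym ({(x, y). {x, y} \<in> induced_edges E S}\<^sup>*)" by (rule sym_rtrancl)
  then show "sym (connected_rel S E)" by (auto simp: sym_def connected_rel_def)
  show "trans (connected_rel S E)" by (auto simp: trans_def connected_rel_def intro: rtrancl_trans)
qed (auto simp: refl_on_def connected_rel_def)

lemma connected_components_adjacent:
  assumes "K \<in> connected_components S (induced_edges E S)" "v \<in> K" "u \<in> S" "{u, v} \<in> E"
  shows "u \<in> K"
proof -
  note K = assms(1)[unfolded connected_components_eq]
  have "v \<in> S" using in_quotient_imp_subset[OF equiv_connected_rel K] assms(2) by blast
  then have "(v, u) \<in> {(x, y). {x, y} \<in> induced_edges E S}\<^sup>*"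
    using assms(3,4) by (intro r_into_rtrancl) (simp add: induced_edges_def insert_commute)
  then have "(v, u) \<in> connected_rel S E"
    using \<open>v \<in> S\<close> assms(3) by (simp add: connected_rel_def)
  then show ?thesis by (rule in_quotient_imp_closed[OF equiv_connected_rel K assms(2)])
qed

lemma connected_components_isolated:
  assumes "K \<in> connected_components S (induced_edges E S)" "v \<in> K" "\<And>u. u \<in> S \<Longrightarrow> {u, v} \<notin> E"
  shows "K = {v}"
proof -
  have "u = v" if "u \<in> K" for u
  proof -
    have "(v, u) \<in> connected_rel S E"
      using in_quotient_imp_in_rel[OF equiv_connected_rel assms(1)[unfolded connected_components_eq]]
        assms(2) that by blast
    then have "(v, u) \<in> {(x, y). {x, y} \<in> induced_edges E S}\<^sup>*" by (simp add: connected_rel_def)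
    then show ?thesis
    proof (cases rule: converse_rtranclE)
      case (step y)
      then have "{v, y} \<in> E" "y \<in> S" by (auto simp: induced_edges_def)
      then show ?thesis using assms(3)[of y] by (simp add: insert_commute)
    qed simp
  qed
  then show ?thesis using assms(2) by blast
qed

lemma connected_components_Union: "\<Union>(connected_components S (induced_edges E S)) = S"
  unfolding connected_components_eq by (rule Union_quotient[OF equiv_connected_rel])

lemma connected_components_disjoint:
  assumes "K \<in> connected_components S (induced_edges E S)"
    and "L \<in> connected_components S (induced_edges E S)" "K \<noteq> L"
  shows "K \<inter> L = {}"
  using assms quotient_disj[OF equiv_connected_rel, of K S E L] unfolding connected_components_eq by blast

text \<open>Elements are added one at a time; the one that first brings the sum up to
  \<open>T\<close> overshoots by at most \<open>w\<close>.\<close>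

lemma subfamily_sum_between:
  fixes f :: "'b \<Rightarrow> real"
  assumes "finite A" "\<And>x. x \<in> A \<Longrightarrow> f x \<le> w" "0 \<le> T" "0 \<le> w" "T \<le> sum f A"
  shows "\<exists>B\<subseteq>A. T \<le> sum f B \<and> sum f B \<le> T + w"
  using assms(1,2,5)
proof (induction A rule: finite_induct)
  case empty
  then show ?case using assms(3,4) by auto
next
  case (insert x A)
  show ?case
  proof (cases "T \<le> sum f A")
    case True
    then obtain B where "B \<subseteq> A" "T \<le> sum f B \<and> sum f B \<le> T + w" using insert by blast
    then show ?thesis by blast
  next
    case False
    moreover have "f x \<le> w" using insert.prems(1) by simp
    ultimately have "T \<le> sum f (insert x A) \<and> sum f (insert x A) \<le> T + w"
      using insert.prems(2) insert.hyps by simp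
    then show ?thesis by blast
  qed
qed

text \<open>Components on which the sum of \<open>f\<close> is less than \<open>\<epsilon>\<close> times their size contribute little, and
  isolated vertices contribute \<open>-2\<close> each, so the others cover a linear part of \<open>S\<close>; as every
  component is small, some of them have a union of prescribed size.\<close>

lemma dense_union_of_components:
  fixes f :: "'a \<Rightarrow> real" and w \<epsilon> :: real
  assumes S: "finite S" and I: "I \<subseteq> S" "\<And>u v. v \<in> I \<Longrightarrow> u \<in> S \<Longrightarrow> {u, v} \<notin> E"
    and f: "\<And>v. v \<in> S \<Longrightarrow> f v \<le> 1" "\<And>v. v \<in> I \<Longrightarrow> f v = -2"
    and small: "\<And>K. K \<in> connected_components S (induced_edges E S) \<Longrightarrow> card K \<le> w"
    and w: "0 \<le> w" and \<epsilon>: "0 \<le> \<epsilon>"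
    and total: "w \<le> sum f S + 2 * card I - \<epsilon> * card S"
  shows "\<exists>U\<subseteq>S. (\<forall>v\<in>U. \<forall>u\<in>S. {u, v} \<in> E \<longrightarrow> u \<in> U) \<and> w \<le> card U \<and> card U \<le> 2 * w
    \<and> \<epsilon> * card U \<le> sum f U"
proof -
  define \<K> where "\<K> = connected_components S (induced_edges E S)"
  define \<D> where "\<D> = {K \<in> \<K>. \<epsilon> * card K \<le> sum f K}"
  have cover: "\<Union>\<K> = S" unfolding \<K>_def by (rule connected_components_Union)
  have disj: "K \<inter> L = {}" if "K \<in> \<K>" "L \<in> \<K>" "K \<noteq> L" for K L
    using that connected_components_disjoint unfolding \<K>_def by blast
  have fin\<K>: "finite \<K>" using S cover by (metis finite_UnionD)
  have finK: "finite K" if "K \<in> \<K>" for K using S cover that by (metis Union_upper finite_subset)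
  have part: "sum g (\<Union>\<A>) = (\<Sum>K\<in>\<A>. sum g K)" if "\<A> \<subseteq> \<K>" for g :: "'a \<Rightarrow> real" and \<A>
    using that disj finK by (intro sum.Union_disjoint[unfolded o_def]) blast+
  have cardU: "real (card (\<Union>\<A>)) = (\<Sum>K\<in>\<A>. real (card K))" if "\<A> \<subseteq> \<K>" for \<A>
    using part[OF that, of "\<lambda>_. 1"] by simp
  \<comment> \<open>A component in \<open>\<D>\<close> contributes at most its size, any other one
    less than \<open>\<epsilon>\<close> times its size. A component meeting \<open>I\<close> is a
    single vertex, and \<open>f v = -2\<close> accounts for the last term.\<close>
  have each: "sum f K \<le> (if K \<in> \<D> then real (card K) else 0) + \<epsilon> * card K - 2 * card (K \<inter> I)"
    if K: "K \<in> \<K>" for K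
  proof (cases "K \<inter> I = {}")
    case True
    have "sum f K \<le> (\<Sum>v\<in>K. 1)" using f(1) K cover by (intro sum_mono) blast
    moreover have "0 \<le> \<epsilon> * card K" using \<epsilon> by simp
    ultimately show ?thesis using True K by (auto simp: \<D>_def)
  next
    case False
    then obtain v where v: "v \<in> K" "v \<in> I" by blast
    then have "K = {v}" using connected_components_isolated[of K S E v] K I(2) unfolding \<K>_def by blast
    then show ?thesis using v f(2) \<epsilon> by auto
  qed
  have "sum f S \<le> (\<Sum>K\<in>\<K>. (if K \<in> \<D> then real (card K) else 0) + \<epsilon> * card K - 2 * card (K \<inter> I))"
    using part[of \<K> f] each unfolding cover by (simp add: sum_mono)
  also have "\<dots> = (\<Sum>K\<in>\<D>. real (card K)) + \<epsilon> * card S - 2 * card I"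
  proof -
    have "S \<inter> I = I" using I(1) by blast
    then have "real (card I) = (\<Sum>K\<in>\<K>. real (card (K \<inter> I)))"
      using part[of \<K> "\<lambda>v. of_bool (v \<in> I)"] S finK unfolding cover
      by (simp cong: sum.cong)
    moreover have "(\<Sum>K\<in>\<K>. if K \<in> \<D> then real (card K) else 0) = (\<Sum>K\<in>\<D>. real (card K))"
      using fin\<K> by (simp add: sum.If_cases \<D>_def Int_def)
    ultimately show ?thesis
      using cardU[of \<K>] cover by (simp add: sum.distrib sum_subtractf sum_distrib_left[symmetric])
  qed
  finally have "w \<le> (\<Sum>K\<in>\<D>. real (card K))" using total by linarith
  moreover have "finite \<D>" using fin\<K> by (simp add: \<D>_def)
  \<comment> \<open>The threshold and the bound on one component are both \<open>w\<close>, which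
    gives the range from \<open>w\<close> to \<open>2 * w\<close>.\<close>
  ultimately obtain \<A> where \<A>: "\<A> \<subseteq> \<D>" "w \<le> (\<Sum>K\<in>\<A>. real (card K))" "(\<Sum>K\<in>\<A>. real (card K)) \<le> w + w"
    using subfamily_sum_between[of \<D> "\<lambda>K. real (card K)" w w] small w by (auto simp: \<D>_def \<K>_def)
  have \<A>\<K>: "\<A> \<subseteq> \<K>" using \<A>(1) by (auto simp: \<D>_def)
  have "\<epsilon> * card (\<Union>\<A>) \<le> sum f (\<Union>\<A>)"
    unfolding cardU[OF \<A>\<K>] part[OF \<A>\<K>] sum_distrib_left using \<A>(1)
    by (intro sum_mono) (auto simp: \<D>_def)
  moreover have "u \<in> \<Union>\<A>" if "v \<in> \<Union>\<A>" "u \<in> S" "{u, v} \<in> E" for u v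
    using that connected_components_adjacent[of _ S E v u] \<A>\<K> unfolding \<K>_def by blast
  ultimately show ?thesis
    using \<A>(2,3) cardU[OF \<A>\<K>] \<A>\<K> cover by (intro exI[of _ "\<Union>\<A>"]) auto
qed

section \<open>The vertices outside \<open>T3\<close>\<close>

context cycle_plus_matching
begin

definition ball1 :: "nat \<Rightarrow> nat set" where
  "ball1 v = insert v (nbrs v)"

definition ball2 :: "nat \<Rightarrow> nat set" where
  "ball2 v = (\<Union>u\<in>ball1 v. ball1 u)"

text \<open>The list argument is meant to be the ordering restricted to a ball, so that independence
  on disjoint balls applies. A vertex of degree 2 always belongs to \<open>T3\<close>, hence the
  degree condition.\<close>

definition local_max :: "nat \<Rightarrow> nat list \<Rightarrow> bool" where
  "local_max v xs \<longleftrightarrow> card (nbrs v) = 3 \<and> (\<forall>u\<in>ball1 v - {v}. precedes xs u v)"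

definition surrounded :: "nat \<Rightarrow> nat list \<Rightarrow> bool" where
  "surrounded v xs \<longleftrightarrow> (\<forall>u\<in>nbrs v. \<forall>w\<in>ball2 v - nbrs v. precedes xs w u)"

lemma ball1_subset: "v < n \<Longrightarrow> ball1 v \<subseteq> {..<n}"
  by (auto simp: ball1_def dest: nbrs_less)

lemma ball2_subset: "v < n \<Longrightarrow> ball2 v \<subseteq> {..<n}"
  using ball1_subset unfolding ball2_def by blast

lemma ball1_sym: "u < n \<Longrightarrow> v < n \<Longrightarrow> u \<in> ball1 v \<Longrightarrow> v \<in> ball1 u"
  using nbrs_sym by (auto simp: ball1_def)

lemma ball2_sym: "u < n \<Longrightarrow> v < n \<Longrightarrow> u \<in> ball2 v \<Longrightarrow> v \<in> ball2 u"
  unfolding ball2_def using ball1_sym ball1_subset by blast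

lemma in_ball1: "v \<in> ball1 v" and in_ball2: "v \<in> ball2 v"
  by (auto simp: ball1_def ball2_def)

lemma finite_balls [simp]: "finite (ball1 v)" "finite (ball2 v)"
  by (auto simp: ball1_def ball2_def)

lemma card_ball1: "v < n \<Longrightarrow> card (ball1 v) = card (nbrs v) + 1"
  using nbrs_irrefl by (simp add: ball1_def)

lemma card_ball1_le: "v < n \<Longrightarrow> card (ball1 v) \<le> 4"
  using card_ball1 card_nbrs_le[of v] by simp

lemma card_ball2_le:
  assumes "v < n"
  shows "card (ball2 v) \<le> 16"
proof -
  have "card (ball2 v) \<le> (\<Sum>u\<in>ball1 v. card (ball1 u))"
    unfolding ball2_def by (rule card_UN_le) simp
  also have "\<dots> \<le> card (ball1 v) * 4"
    using sum_bounded_above[of "ball1 v" "\<lambda>u. card (ball1 u)" 4] card_ball1_le ball1_subset[OF assms]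
    by auto
  finally show ?thesis using card_ball1_le[OF assms] by linarith
qed

abbreviation edges :: "nat set set" where
  "edges \<equiv> cycle_edges n \<union> M"

lemma earlier_nbrs_eq: "{u \<in> {..<n}. {u, v} \<in> edges \<and> precedes \<pi> u v} = {u \<in> nbrs v. precedes \<pi> u v}"
  by (auto simp: nbrs_def)

lemma in_T3_iff: "v \<in> T3 {..<n} edges \<pi> \<longleftrightarrow> v < n \<and> card {u \<in> nbrs v. precedes \<pi> u v} \<le> 2"
  unfolding T3_def earlier_nbrs_eq by simp

lemma T3_subset: "T3 {..<n} edges \<pi> \<subseteq> {..<n}"
  by (auto simp: in_T3_iff)

text \<open>The degree is at most 3, so more than two earlier neighbours means that all three are
  earlier.\<close>

lemma local_max_if_not_T3:
  assumes "v < n" "v \<notin> T3 {..<n} edges \<pi>"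
  shows "local_max v (filter (\<lambda>x. x \<in> ball1 v) \<pi>)"
proof -
  let ?A = "{u \<in> nbrs v. precedes \<pi> u v}"
  have "3 \<le> card ?A" using assms by (simp add: in_T3_iff)
  moreover have "card ?A \<le> card (nbrs v)" by (intro card_mono) auto
  ultimately have eq: "card (nbrs v) = 3" "card ?A = card (nbrs v)"
    using card_nbrs_le[OF assms(1)] by auto
  then have "?A = nbrs v" by (intro card_subset_eq) auto
  then show ?thesis using eq(1) by (auto simp: local_max_def precedes_filter ball1_def)
qed

text \<open>As \<open>v\<close> precedes its neighbours, it belongs to \<open>T3\<close>. For a
  neighbour \<open>u\<close>, tree-likeness puts all three neighbours of \<open>u\<close> inside
  \<open>ball2 v\<close> and outside \<open>nbrs v\<close>, so they precede \<open>u\<close> and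
  exclude it from \<open>T3\<close>.\<close>

lemma isolated_if_surrounded:
  assumes "v < n" "tree_like v" "distinct \<pi>" "surrounded v (filter (\<lambda>x. x \<in> ball2 v) \<pi>)"
  shows "v \<in> T3 {..<n} edges \<pi>" "nbrs v \<inter> T3 {..<n} edges \<pi> = {}"
proof -
  have before: "precedes \<pi> w u" if "u \<in> nbrs v" "w \<in> ball2 v" "w \<notin> nbrs v" for u w
    using assms(4) that by (auto simp: surrounded_def precedes_filter)
  have "{u \<in> nbrs v. precedes \<pi> u v} = {}"
    using before[OF _ in_ball2 nbrs_irrefl[OF assms(1)]] precedes_asym[OF assms(3)] by blast
  then show "v \<in> T3 {..<n} edges \<pi>" using assms(1) by (simp only: in_T3_iff) simp
  show "nbrs v \<inter> T3 {..<n} edges \<pi> = {}"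
  proof (rule ccontr)
    assume "nbrs v \<inter> T3 {..<n} edges \<pi> \<noteq> {}"
    then obtain u where u: "u \<in> nbrs v" "u \<in> T3 {..<n} edges \<pi>" by blast
    have "nbrs u \<subseteq> ball2 v" using u(1) by (auto simp: ball1_def ball2_def)
    moreover have "card (nbrs u) = 3" "nbrs u \<inter> nbrs v = {}"
      using assms(2) u(1) by (auto simp: tree_like_def)
    ultimately have "{w \<in> nbrs u. precedes \<pi> w u} = nbrs u" using before[OF u(1)] by blast
    then show False using u(2) \<open>card (nbrs u) = 3\<close> by (simp add: in_T3_iff)
  qed
qed

lemma order_prob_local_max:
  assumes "v < n"
  shows "order_prob (ball1 v) (local_max v) \<le> 1 / 4"
proof (cases "card (nbrs v) = 3")
  case True
  have "order_prob (ball1 v) (local_max v) \<le> order_prob (ball1 v) (\<lambda>\<pi>. \<forall>u\<in>ball1 v - {v}. precedes \<pi> u v)"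
    by (rule order_prob_mono) (simp add: local_max_def)
  also have "\<dots> \<le> 1 / card (ball1 v)" by (rule order_prob_last_le) (auto simp: in_ball1)
  also have "card (ball1 v) = 4" using card_ball1[OF assms] True by simp
  finally show ?thesis by simp
next
  case False
  then show ?thesis by (simp add: order_prob_eq_card local_max_def)
qed

lemma order_prob_surrounded:
  assumes "v < n"
  shows "1 / fact 16 \<le> order_prob (ball2 v) (surrounded v)"
proof -
  have "1 / fact 16 \<le> (1 / fact (card (ball2 v)) :: real)"
    using card_ball2_le[OF assms] by (intro divide_left_mono fact_mono) auto
  also have "\<dots> \<le> order_prob (ball2 v) (surrounded v)"
    unfolding surrounded_def
    by (rule order_prob_last_block_ge) (auto simp: ball1_def ball2_def)
  finally show ?thesis .
qed

text \<open>Balls of radius 1 have at most 4 vertices, which gives \<open>4 * 4\<close> colours. A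
  class is unlikely to exceed a quarter of its size by \<open>t * n\<close>; the sixteen allowances
  and the sixteen failure probabilities add up.\<close>

lemma order_prob_many_outside_T3:
  fixes t :: real
  assumes "0 < t" "t \<le> 1"
  shows "order_prob {..<n} (\<lambda>\<pi>. real n / 4 + 16 * t * n \<le> card ({..<n} - T3 {..<n} edges \<pi>))
    \<le> 16 * exp (- (t\<^sup>2 / 8) * n)"
proof -
  have "\<exists>col. (\<forall>v\<in>{..<n}. col v < 4 * 4)
      \<and> (\<forall>i :: nat. disjoint_family_on ball1 {v \<in> {..<n}. col v = i})"
    by (rule disjoint_balls_colouring) (simp_all add: ball1_subset in_ball1 ball1_sym card_ball1_le)
  then obtain col where col: "\<forall>v\<in>{..<n}. col v < 4 * 4"
    "\<forall>i :: nat. disjoint_family_on ball1 {v \<in> {..<n}. col v = i}" by blast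
  define J where "J i = {v \<in> {..<n}. col v = i}" for i
  define X where "X i \<pi> = {v \<in> J i. local_max v (filter (\<lambda>x. x \<in> ball1 v) \<pi>)}" for i \<pi>
  have J: "finite (J i)" "J i \<subseteq> {..<n}" for i by (auto simp: J_def)
  have "card (J i) \<le> n" for i using card_mono[OF _ J(2)] by simp
  then have tail: "order_prob {..<n} (\<lambda>\<pi>. 1 / 4 * card (J i) + t * n \<le> card (X i \<pi>))
      \<le> exp (- (t\<^sup>2 / 8) * n)" for i
    unfolding X_def using col(2) assms order_prob_local_max J ball1_subset
    by (intro order_prob_upper_tail) (auto simp: J_def)
  have sumJ: "(\<Sum>i<16. real (card (J i))) = n"
  proof -
    have "{..<n} = (\<Union>i<16. J i)" using col(1) by (auto simp: J_def)
    then have "card {..<n} = (\<Sum>i<16. card (J i))"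
      using J(1) by (simp only:) (rule card_UN_disjoint, auto simp: J_def)
    then show ?thesis by simp
  qed
  have "\<exists>i\<in>{..<16}. 1 / 4 * card (J i) + t * n \<le> card (X i \<pi>)"
    if "real n / 4 + 16 * t * n \<le> card ({..<n} - T3 {..<n} edges \<pi>)" for \<pi>
  proof (rule ccontr)
    assume "\<not> ?thesis"
    then have less: "card (X i \<pi>) < 1 / 4 * card (J i) + t * n" if "i < 16" for i
      using that by force
    have "{..<n} - T3 {..<n} edges \<pi> \<subseteq> (\<Union>i<16. X i \<pi>)"
      using local_max_if_not_T3 col(1) by (auto simp: X_def J_def)
    then have "card ({..<n} - T3 {..<n} edges \<pi>) \<le> card (\<Union>i<16. X i \<pi>)"
      using J(1) by (intro card_mono) (auto simp: X_def)
    also have "\<dots> \<le> (\<Sum>i<16. card (X i \<pi>))" by (rule card_UN_le) simp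
    finally have "real (card ({..<n} - T3 {..<n} edges \<pi>)) \<le> (\<Sum>i<16. real (card (X i \<pi>)))"
      unfolding of_nat_sum[symmetric] of_nat_le_iff .
    also have "\<dots> < (\<Sum>i<16. 1 / 4 * card (J i) + t * n)"
      using less by (intro sum_strict_mono) (auto simp: lessThan_empty_iff)
    also have "\<dots> = real n / 4 + 16 * t * n"
      unfolding sum.distrib sum_distrib_left[symmetric] sumJ by simp
    finally show False using that by simp
  qed
  then have "order_prob {..<n} (\<lambda>\<pi>. real n / 4 + 16 * t * n \<le> card ({..<n} - T3 {..<n} edges \<pi>))
      \<le> order_prob {..<n} (\<lambda>\<pi>. \<exists>i\<in>{..<16}. 1 / 4 * card (J i) + t * n \<le> card (X i \<pi>))"
    by (intro order_prob_mono)
  also have "\<dots> \<le> (\<Sum>i<16. order_prob {..<n} (\<lambda>\<pi>. 1 / 4 * card (J i) + t * n \<le> card (X i \<pi>)))"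
    by (rule order_prob_Bex_le) simp
  also have "\<dots> \<le> (\<Sum>i<(16::nat). exp (- (t\<^sup>2 / 8) * n))"
    using tail by (intro sum_mono)
  finally show ?thesis by simp
qed

text \<open>One colour class is enough. By averaging over 256 colours, some class holds at least
  \<open>n / 512\<close> tree-like vertices, and on it the \<open>surrounded\<close> events are
  independent.\<close>

lemma order_prob_few_isolated:
  assumes half: "real n / 2 \<le> card {v \<in> {..<n}. tree_like v}"
  shows "order_prob {..<n} (\<lambda>\<pi>. card {v \<in> T3 {..<n} edges \<pi>. nbrs v \<inter> T3 {..<n} edges \<pi> = {}}
      \<le> 1 / fact 16 / 2048 * real n) \<le> exp (- (1 / fact 16 / 2048) * real n)"
proof -
  define p :: real where "p = 1 / fact 16"
  have p: "0 < p" by (simp add: p_def)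
  have "\<exists>col. (\<forall>v\<in>{..<n}. col v < 16 * 16)
      \<and> (\<forall>i :: nat. disjoint_family_on ball2 {v \<in> {..<n}. col v = i})"
    by (rule disjoint_balls_colouring) (simp_all add: ball2_subset in_ball2 ball2_sym card_ball2_le)
  then obtain col where col: "\<forall>v\<in>{..<n}. col v < 16 * 16"
    "\<forall>i :: nat. disjoint_family_on ball2 {v \<in> {..<n}. col v = i}" by blast
  define J where "J i = {v \<in> {..<n}. tree_like v \<and> col v = i}" for i
  have J: "finite (J i)" for i by (auto simp: J_def)
  have "\<exists>i<256. real n / 512 \<le> card (J i)"
  proof (rule ccontr)
    assume "\<not> ?thesis"
    then have less: "card (J i) < real n / 512" if "i < 256" for i using that by force
    have "{v \<in> {..<n}. tree_like v} = (\<Union>i<256. J i)" using col(1) by (auto simp: J_def)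
    then have "card {v \<in> {..<n}. tree_like v} \<le> (\<Sum>i<256. card (J i))"
      using card_UN_le[of "{..<256}" J] by simp
    then have "real (card {v \<in> {..<n}. tree_like v}) \<le> (\<Sum>i<256. real (card (J i)))"
      unfolding of_nat_sum[symmetric] of_nat_le_iff .
    also have "\<dots> < (\<Sum>i<(256::nat). real n / 512)"
      using less by (intro sum_strict_mono) (auto simp: lessThan_empty_iff)
    finally show False using half by simp
  qed
  then obtain i where i: "real n / 512 \<le> card (J i)" by blast
  define X where "X \<pi> = {v \<in> J i. surrounded v (filter (\<lambda>x. x \<in> ball2 v) \<pi>)}" for \<pi>
  have "disjoint_family_on ball2 (J i)"
    using col(2) by (rule disjoint_family_on_mono[rotated, OF spec[of _ i]]) (auto simp: J_def)
  then have tail: "order_prob {..<n} (\<lambda>\<pi>. card (X \<pi>) \<le> p * card (J i) / 4) \<le> exp (- (p * card (J i) / 4))"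
    unfolding X_def using order_prob_surrounded J ball2_subset p
    by (intro order_prob_lower_tail) (auto simp: J_def p_def)
  have large: "p / 2048 * n \<le> p * card (J i) / 4"
    using mult_left_mono[OF i, of "p / 4"] p by (simp add: field_simps)
  have "card (X \<pi>) \<le> p * card (J i) / 4"
    if \<pi>: "\<pi> \<in> permutations_of_set {..<n}"
      and few: "card {v \<in> T3 {..<n} edges \<pi>. nbrs v \<inter> T3 {..<n} edges \<pi> = {}} \<le> p / 2048 * real n" for \<pi>
  proof -
    have "X \<pi> \<subseteq> {v \<in> T3 {..<n} edges \<pi>. nbrs v \<inter> T3 {..<n} edges \<pi> = {}}"
    proof
      fix v assume "v \<in> X \<pi>"
      then have "v < n" "tree_like v" "surrounded v (filter (\<lambda>x. x \<in> ball2 v) \<pi>)"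
        by (auto simp: X_def J_def)
      then show "v \<in> {v \<in> T3 {..<n} edges \<pi>. nbrs v \<inter> T3 {..<n} edges \<pi> = {}}"
        using isolated_if_surrounded permutations_of_setD(2)[OF \<pi>] by blast
    qed
    then have "card (X \<pi>) \<le> card {v \<in> T3 {..<n} edges \<pi>. nbrs v \<inter> T3 {..<n} edges \<pi> = {}}"
      using finite_subset[OF T3_subset finite_lessThan] by (intro card_mono) simp_all
    then show ?thesis using few large by linarith
  qed
  then have "order_prob {..<n} (\<lambda>\<pi>. card {v \<in> T3 {..<n} edges \<pi>. nbrs v \<inter> T3 {..<n} edges \<pi> = {}}
      \<le> p / 2048 * real n) \<le> order_prob {..<n} (\<lambda>\<pi>. card (X \<pi>) \<le> p * card (J i) / 4)"
    by (intro order_prob_mono)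
  also note tail
  also have "exp (- (p * card (J i) / 4)) \<le> exp (- (p / 2048) * n)" using large by simp
  finally show ?thesis unfolding p_def .
qed

text \<open>The excess sum over \<open>T3\<close> is at least
  \<open>- (\<alpha> + \<beta>) * n\<close>. The isolated vertices contribute -2 each, so leaving
  them out raises it by at least \<open>2 * c1 * n\<close>. This pays for the deficit, for
  \<open>\<epsilon>\<close> per vertex, and for the size \<open>\<delta> * n\<close> demanded by
  \<open>dense_union_of_components\<close>.\<close>

lemma small_components_dense_set:
  fixes \<delta> \<epsilon> \<alpha> \<beta> c1 :: real and \<pi>
  defines "S \<equiv> T3 {..<n} edges \<pi>"
  assumes short: "8 * card (M \<inter> short_pairs n) \<le> \<alpha> * n"
    and out: "4 * card ({..<n} - S) \<le> (1 + \<beta>) * n"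
    and iso: "c1 * n \<le> card {v \<in> S. nbrs v \<inter> S = {}}"
    and small: "\<And>K. K \<in> connected_components S (induced_edges edges S) \<Longrightarrow> card K \<le> \<delta> * n"
    and pos: "0 < \<delta>" "0 < \<epsilon>" and param: "\<delta> + \<alpha> + \<beta> + \<epsilon> \<le> 2 * c1" and n: "4 \<le> \<epsilon> * \<delta> * n"
  shows "\<exists>U\<subseteq>{..<n}. \<delta> * n \<le> card U \<and> card U \<le> 2 * (\<delta> * n)
    \<and> segments U + \<epsilon> / 4 * card U \<le> card (M \<inter> Pow U)"
proof -
  define f where "f v = real (card (nbrs v \<inter> S)) - 2" for v
  define I where "I = {v \<in> S. nbrs v \<inter> S = {}}"
  have SV: "S \<subseteq> {..<n}" unfolding S_def by (rule T3_subset)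
  have finS: "finite S" using SV finite_subset by blast
  have adj: "u \<in> nbrs v" if "u \<in> S" "{u, v} \<in> edges" for u v
    using that SV by (auto simp: nbrs_def)
  have f1: "f v \<le> 1" if "v \<in> S" for v
  proof -
    have "card (nbrs v \<inter> S) \<le> card (nbrs v)" by (intro card_mono) auto
    then show ?thesis using card_nbrs_le[of v] that SV by (auto simp: f_def)
  qed
  have "card S \<le> n" using card_mono[OF _ SV] by simp
  then have "\<epsilon> * card S \<le> \<epsilon> * n" using pos by (intro mult_left_mono) auto
  moreover have "- (\<alpha> + \<beta>) * n \<le> sum f S"
    using sum_excess_ge[OF SV] short out unfolding f_def by (simp add: algebra_simps)
  moreover have "(\<delta> + \<alpha> + \<beta> + \<epsilon>) * n \<le> 2 * c1 * n" using param by (intro mult_right_mono) auto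
  ultimately have total: "\<delta> * n \<le> sum f S + 2 * card I - \<epsilon> * card S"
    using iso unfolding I_def by (simp add: algebra_simps)
  have isolated: "{u, v} \<notin> edges" if "v \<in> I" "u \<in> S" for u v
    using adj[OF that(2), of v] that by (auto simp: I_def)
  have "\<exists>U\<subseteq>S. (\<forall>v\<in>U. \<forall>u\<in>S. {u, v} \<in> edges \<longrightarrow> u \<in> U) \<and> \<delta> * n \<le> card U \<and> card U \<le> 2 * (\<delta> * n)
      \<and> \<epsilon> * card U \<le> sum f U"
  proof (rule dense_union_of_components[OF finS _ isolated f1 _ small _ _ total])
    show "I \<subseteq> S" by (auto simp: I_def)
    show "f v = - 2" if "v \<in> I" for v using that by (simp add: I_def f_def)
  qed (use pos in auto)
  then obtain U where U: "U \<subseteq> S" "\<forall>v\<in>U. \<forall>u\<in>S. {u, v} \<in> edges \<longrightarrow> u \<in> U" "\<delta> * n \<le> card U"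
    "card U \<le> 2 * (\<delta> * n)" "\<epsilon> * card U \<le> sum f U" by blast
  have UV: "U \<subseteq> {..<n}" using U(1) SV by blast
  \<comment> \<open>\<open>U\<close> is closed under adjacency in \<open>S\<close>, so induced
    degrees in \<open>S\<close> and in \<open>U\<close> agree.\<close>
  have "nbrs v \<inter> S = nbrs v \<inter> U" if "v \<in> U" for v
  proof (intro equalityI subsetI)
    fix u assume u: "u \<in> nbrs v \<inter> S"
    then have "{u, v} \<in> edges" by (simp add: nbrs_def)
    then show "u \<in> nbrs v \<inter> U" using U(2) that u by blast
  qed (use U(1) in auto)
  then have "sum f U = (\<Sum>v\<in>U. real (card (nbrs v \<inter> U)) - 2)" unfolding f_def by simp
  also have "\<dots> = real (\<Sum>v\<in>U. card (nbrs v \<inter> U)) - 2 * card U" by (simp add: sum_subtractf)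
  also have "real (\<Sum>v\<in>U. card (nbrs v \<inter> U)) \<le> 2 * card U + 2 + 2 * card (M \<inter> Pow U) - 2 * real (segments U)"
    using sum_card_nbrs_le[OF UV] by linarith
  finally have "sum f U \<le> 2 + 2 * card (M \<inter> Pow U) - 2 * real (segments U)" by simp
  \<comment> \<open>Then \<open>\<epsilon> / 2 * card U - 1 \<ge> \<epsilon> / 4 * card U\<close>:
    halving the coefficient absorbs the closing edge.\<close>
  moreover have "4 \<le> \<epsilon> * card U"
    using n mult_left_mono[OF U(3), of \<epsilon>] pos(2) unfolding mult.assoc by linarith
  ultimately have "segments U + \<epsilon> / 4 * card U \<le> card (M \<inter> Pow U)" using U(5) by simp
  then show ?thesis using UV U(3,4) by blast
qed

end

section \<open>Sets containing too many matching edges\<close>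

lemma segments_insert:
  assumes "U \<subseteq> {..<n}"
  shows "segments (insert n U) = segments U + of_bool (n = 0 \<or> n - 1 \<notin> U)"
proof -
  have fin: "finite U" using assms finite_subset by blast
  have "n \<notin> U" using assms by auto
  have "{x \<in> insert n U. x = 0 \<or> x - 1 \<notin> insert n U}
      = {x \<in> U. x = 0 \<or> x - 1 \<notin> U} \<union> (if n = 0 \<or> n - 1 \<notin> U then {n} else {})"
    using assms by force
  then show ?thesis
    unfolding segments_def using fin \<open>n \<notin> U\<close> by (simp add: card_insert_if)
qed

text \<open>The extra factor 2 for sets containing the last point makes the induction go through: a
  set containing it can be continued for free, and its weight is halved.\<close>

lemma sum_segment_weights:
  fixes w :: real
  assumes "0 \<le> w"
  shows "(\<Sum>U\<in>Pow {..<n}. (1 / 2) ^ card U * w ^ segments U) \<le> (1 + w) ^ n"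
proof -
  define g where "g U = (1 / 2) ^ card U * w ^ segments U" for U
  define h where "h n U = g U * (if 0 < n \<and> n - 1 \<in> U then 2 else 1)" for n U
  have g0: "0 \<le> g U" for U using assms by (simp add: g_def)
  have "(\<Sum>U\<in>Pow {..<n}. h n U) \<le> (1 + w) ^ n"
  proof (induction n)
    case 0
    then show ?case by (simp add: h_def g_def segments_def)
  next
    case (Suc n)
    have insert: "g (insert n U) = g U / 2 * (if 0 < n \<and> n - 1 \<in> U then 1 else w)"
      if "U \<subseteq> {..<n}" for U
    proof -
      have "finite U" "n \<notin> U" using that finite_subset by auto
      then show ?thesis using segments_insert[OF that] by (auto simp: g_def)
    qed
    \<comment> \<open>If \<open>n - 1\<close> is in \<open>U\<close>, both continuations together
      weigh \<open>2 * g U = h n U\<close>; otherwise they weigh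
      \<open>(1 + w) * g U\<close>.\<close>
    have step: "h (Suc n) U + h (Suc n) (insert n U) \<le> (1 + w) * h n U" if "U \<subseteq> {..<n}" for U
    proof -
      have "n \<notin> U" using that by auto
      then have "h (Suc n) U + h (Suc n) (insert n U)
          = g U * (1 + (if 0 < n \<and> n - 1 \<in> U then 1 else w))"
        using insert[OF that] by (simp add: h_def algebra_simps)
      also have "\<dots> \<le> (1 + w) * h n U"
        using g0[of U] assms by (auto simp: h_def algebra_simps)
      finally show ?thesis .
    qed
    have "(\<Sum>U\<in>Pow {..<Suc n}. h (Suc n) U)
        = (\<Sum>U\<in>Pow {..<n}. h (Suc n) U) + (\<Sum>U\<in>insert n ` Pow {..<n}. h (Suc n) U)"
      unfolding lessThan_Suc Pow_insert by (rule sum.union_disjoint) auto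
    also have "(\<Sum>U\<in>insert n ` Pow {..<n}. h (Suc n) U) = (\<Sum>U\<in>Pow {..<n}. h (Suc n) (insert n U))"
    proof (subst sum.reindex)
      show "inj_on (insert n) (Pow {..<n})"
        by (rule inj_onI) (metis PowD insert_ident lessThan_iff less_irrefl subsetD)
    qed simp
    also have "(\<Sum>U\<in>Pow {..<n}. h (Suc n) U) + (\<Sum>U\<in>Pow {..<n}. h (Suc n) (insert n U))
        \<le> (\<Sum>U\<in>Pow {..<n}. (1 + w) * h n U)"
      unfolding sum.distrib[symmetric] using step by (intro sum_mono) auto
    also have "\<dots> \<le> (1 + w) ^ Suc n"
      using Suc.IH assms by (simp add: sum_distrib_left[symmetric] mult_left_mono)
    finally show ?case .
  qed
  moreover have "(\<Sum>U\<in>Pow {..<n}. g U) \<le> (\<Sum>U\<in>Pow {..<n}. h n U)"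
    using g0 by (intro sum_mono) (auto simp: h_def)
  ultimately show ?thesis by (simp add: g_def)
qed

section \<open>Matchings with many short edges, and matchings with a dense set\<close>

lemma card_matchings_many_short:
  assumes "8 \<le> n" "4 * k \<le> n"
  shows "real (card {M \<in> perfect_matchings {..<n}. k \<le> card (M \<inter> short_pairs n)})
    \<le> exp 32 * (1 / 2) ^ k * card (perfect_matchings {..<n})"
proof -
  have "real (card {M \<in> perfect_matchings {..<n}. k \<le> card (M \<inter> short_pairs n)})
      \<le> real (card (short_pairs n) choose k) * (2 / n) ^ k * card (perfect_matchings {..<n})"
    using card_perfect_matchings_many_edges[of "{..<n}" "short_pairs n" k] assms
    by (simp add: lessThan_empty_iff)
  \<comment> \<open>There are at most \<open>8 * n\<close> short pairs, hence \<open>r = 16\<close>;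
    \<open>t = 32\<close> makes the ratio \<open>1 / 2\<close>.\<close>
  also have "real (card (short_pairs n) choose k) * (2 / n) ^ k \<le> exp 32 * (16 / 32) ^ k"
  proof (rule choose_mult_power_le_exp)
    have "real (card (short_pairs n)) \<le> 8 * n" using card_short_pairs[of n] assms by linarith
    then show "real (card (short_pairs n)) * (2 / n) \<le> 16" using assms by (simp add: field_simps)
  qed auto
  finally show ?thesis by (simp add: mult_right_mono)
qed

text \<open>The moment bound gives \<open>exp (2 * \<delta> * n)\<close> times \<open>k\<close>
  factors \<open>2 * \<delta>\<close>. Of these, \<open>segments U\<close> are kept as a weight and
  the rest give \<open>exp (- 7 * \<delta> * n)\<close>. From the resulting exponent -5, in units of
  \<open>\<delta> * n\<close>, 2 units buy the weight \<open>(1 / 2) ^ card U\<close>, which leaves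
  -3 for the sum over \<open>U\<close>.\<close>

lemma card_matchings_dense_set:
  fixes \<delta> \<epsilon> :: real
  assumes n: "8 \<le> n" and U: "U \<subseteq> {..<n}" "\<delta> * n \<le> card U" "card U \<le> 2 * (\<delta> * n)"
    and \<delta>: "0 < \<delta>" "\<delta> \<le> 1 / 32" "2 * \<delta> \<le> exp (- (28 / \<epsilon>))" and \<epsilon>: "0 < \<epsilon>" "\<epsilon> \<le> 4"
  shows "real (card {M \<in> perfect_matchings {..<n}. segments U + \<epsilon> / 4 * card U \<le> card (M \<inter> Pow U)})
    \<le> exp (- 3 * \<delta> * n) * ((1 / 2) ^ card U * (2 * \<delta>) ^ segments U) * card (perfect_matchings {..<n})"
proof -
  define H where "H = {e. e \<subseteq> U \<and> card e = 2}"
  define k where "k = nat \<lceil>segments U + \<epsilon> / 4 * card U\<rceil>"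
  have fin: "finite U" using U(1) finite_subset by blast
  have cH: "card H = card U choose 2" unfolding H_def using n_subsets[OF fin] .
  have finH: "finite H" unfolding H_def using fin by (auto intro: finite_subset[of _ "Pow U"])
  have MH: "M \<inter> H = M \<inter> Pow U" if "M \<in> perfect_matchings {..<n}" for M
    using that by (auto simp: H_def perfect_matchings_def)
  have kge: "segments U + \<epsilon> / 4 * card U \<le> k" unfolding k_def by linarith
  have kle: "k < segments U + \<epsilon> / 4 * card U + 1"
    unfolding k_def using \<epsilon> by (simp add: nat_less_real_le) linarith
  have segU: "segments U \<le> card U" unfolding segments_def using fin by (intro card_mono) auto
  have "\<epsilon> / 4 * card U \<le> 1 * real (card U)" using \<epsilon> by (intro mult_right_mono) auto
  then have "real k \<le> 2 * card U + 1" using kle segU by linarith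
  also have "\<dots> \<le> 4 * (\<delta> * n) + 1" using U(3) by simp
  also have "\<dots> \<le> n / 8 + 1" using \<delta>(2) mult_right_mono[of \<delta> "1/32" "real n"] by simp
  \<comment> \<open>Since \<open>8 \<le> n\<close>,
    \<open>4 * k \<le> n / 2 + 4 \<le> n\<close>.\<close>
  finally have k4: "4 * k \<le> n" using n by linarith
  have r: "real (card H) * (2 / n) \<le> 4 * \<delta>\<^sup>2 * n"
  proof -
    have "2 * card H \<le> card U * (card U - 1)" unfolding cH choose_two by (rule times_div_less_eq_dividend)
    also have "\<dots> \<le> card U * card U" by simp
    finally have "2 * card H \<le> card U * card U" .
    then have "2 * real (card H) \<le> real (card U) * real (card U)"
      by (metis of_nat_le_iff of_nat_mult of_nat_numeral)
    also have "\<dots> \<le> (2 * (\<delta> * n)) * (2 * (\<delta> * n))" using U(3) by (intro mult_mono) auto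
    finally show ?thesis using n by (simp add: field_simps power2_eq_square)
  qed
  have "{M \<in> perfect_matchings {..<n}. segments U + \<epsilon> / 4 * card U \<le> card (M \<inter> Pow U)}
      \<subseteq> {M \<in> perfect_matchings {..<n}. k \<le> card (M \<inter> H)}"
    using MH unfolding k_def by (auto simp: nat_le_iff ceiling_le_iff)
  then have "real (card {M \<in> perfect_matchings {..<n}. segments U + \<epsilon> / 4 * card U \<le> card (M \<inter> Pow U)})
      \<le> real (card {M \<in> perfect_matchings {..<n}. k \<le> card (M \<inter> H)})"
    by (intro of_nat_mono card_mono) (auto simp: finite_perfect_matchings)
  also have "\<dots> \<le> real (card H choose k) * (2 / n) ^ k * card (perfect_matchings {..<n})"
    using card_perfect_matchings_many_edges[of "{..<n}" H k] finH k4 n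
    by (simp add: lessThan_empty_iff)
  \<comment> \<open>Here \<open>t = 2 * \<delta> * n\<close>, so that the ratio \<open>r / t\<close>
    is \<open>2 * \<delta>\<close>.\<close>
  also have "real (card H choose k) * (2 / n) ^ k \<le> exp (2 * \<delta> * n) * (4 * \<delta>\<^sup>2 * n / (2 * \<delta> * n)) ^ k"
    using r \<delta> n by (intro choose_mult_power_le_exp) auto
  also have "4 * \<delta>\<^sup>2 * n / (2 * \<delta> * n) = 2 * \<delta>" using \<delta> n by (simp add: field_simps power2_eq_square)
  \<comment> \<open>At least \<open>\<epsilon> / 4 * \<delta> * n\<close> factors exceed the number
    of segments, each at most \<open>exp (- (28 / \<epsilon>))\<close>; the constant is
    \<open>28 = 4 * 7\<close>.\<close>
  also have "(2 * \<delta>) ^ k \<le> (2 * \<delta>) ^ segments U * exp (- 7 * \<delta> * n)"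
  proof -
    define m where "m = k - segments U"
    have "0 \<le> \<epsilon> / 4 * card U" using \<epsilon> by simp
    then have km: "k = segments U + m" using kge unfolding m_def by linarith
    then have "\<epsilon> / 4 * card U \<le> m" using kge by simp
    have "\<epsilon> / 4 * (\<delta> * n) \<le> \<epsilon> / 4 * card U" using U(2) \<epsilon> by (intro mult_left_mono) auto
    then have "\<epsilon> * (\<delta> * n) \<le> 4 * m" using \<open>\<epsilon> / 4 * card U \<le> m\<close> by simp
    then have "7 * \<delta> * n \<le> real m * (28 / \<epsilon>)" using \<epsilon> by (simp add: field_simps)
    have "(2 * \<delta>) ^ m \<le> exp (- (28 / \<epsilon>)) ^ m" using \<delta> by (intro power_mono) auto
    also have "\<dots> = exp (- (real m * (28 / \<epsilon>)))" by (simp add: exp_of_nat_mult[symmetric])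
    also have "\<dots> \<le> exp (- 7 * \<delta> * n)" using \<open>7 * \<delta> * n \<le> real m * (28 / \<epsilon>)\<close> by simp
    finally show ?thesis unfolding km power_add using \<delta> by (intro mult_left_mono) auto
  qed
  also have "exp (2 * \<delta> * n) * ((2 * \<delta>) ^ segments U * exp (- 7 * \<delta> * n))
      = exp (- 5 * \<delta> * n) * (2 * \<delta>) ^ segments U"
    by (simp add: exp_add[symmetric])
  also have "\<dots> \<le> exp (- 3 * \<delta> * n) * (1 / 2) ^ card U * (2 * \<delta>) ^ segments U"
  proof (intro mult_right_mono)
    have "2 \<le> exp (1 :: real)" using exp_ge_add_one_self[of "1 :: real"] by simp
    then have "2 ^ card U \<le> exp (1 :: real) ^ card U" by (intro power_mono) auto
    also have "\<dots> = exp (real (card U))" by (simp add: exp_of_nat_mult[symmetric])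
    also have "\<dots> \<le> exp (2 * \<delta> * n)" using U(3) by simp
    finally have "exp (- 5 * \<delta> * n) * 2 ^ card U \<le> exp (- 5 * \<delta> * n) * exp (2 * \<delta> * n)"
      by (intro mult_left_mono) auto
    also have "\<dots> = exp (- 3 * \<delta> * n)" by (simp add: exp_add[symmetric])
    finally show "exp (- 5 * \<delta> * n) \<le> exp (- 3 * \<delta> * n) * (1 / 2) ^ card U"
      by (simp add: power_divide field_simps)
  qed (use \<delta> in auto)
  finally show ?thesis by (simp add: mult_right_mono mult.assoc)
qed

text \<open>In the union bound over \<open>U\<close>, \<open>sum_segment_weights\<close> with
  \<open>w = 2 * \<delta>\<close> costs at most \<open>exp (2 * \<delta> * n)\<close>, which leaves
  one of the three units of the exponent.\<close>

lemma card_matchings_some_dense_set: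
  fixes \<delta> \<epsilon> :: real
  assumes n: "8 \<le> n" and \<delta>: "0 < \<delta>" "\<delta> \<le> 1 / 32" "2 * \<delta> \<le> exp (- (28 / \<epsilon>))"
    and \<epsilon>: "0 < \<epsilon>" "\<epsilon> \<le> 4"
  shows "real (card {M \<in> perfect_matchings {..<n}. \<exists>U\<subseteq>{..<n}. \<delta> * n \<le> card U \<and> card U \<le> 2 * (\<delta> * n)
      \<and> segments U + \<epsilon> / 4 * card U \<le> card (M \<inter> Pow U)})
    \<le> exp (- \<delta> * n) * card (perfect_matchings {..<n})"
proof -
  let ?P = "perfect_matchings {..<n}"
  define A where "A U = {M \<in> ?P. segments U + \<epsilon> / 4 * card U \<le> card (M \<inter> Pow U)}" for U
  define \<U> where "\<U> = {U. U \<subseteq> {..<n} \<and> \<delta> * n \<le> card U \<and> card U \<le> 2 * (\<delta> * n)}"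
  have \<U>: "finite \<U>" "\<U> \<subseteq> Pow {..<n}" by (auto simp: \<U>_def intro: finite_subset[of _ "Pow {..<n}"])
  have "{M \<in> ?P. \<exists>U\<subseteq>{..<n}. \<delta> * n \<le> card U \<and> card U \<le> 2 * (\<delta> * n)
      \<and> segments U + \<epsilon> / 4 * card U \<le> card (M \<inter> Pow U)} = (\<Union>U\<in>\<U>. A U)"
    by (auto simp: \<U>_def A_def)
  also have "real (card (\<Union>U\<in>\<U>. A U)) \<le> (\<Sum>U\<in>\<U>. real (card (A U)))"
    using card_UN_le[OF \<U>(1), of A] unfolding of_nat_sum[symmetric] of_nat_le_iff .
  also have "\<dots> \<le> (\<Sum>U\<in>\<U>. exp (- 3 * \<delta> * n) * ((1 / 2) ^ card U * (2 * \<delta>) ^ segments U) * card ?P)"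
    using card_matchings_dense_set[OF n _ _ _ \<delta> \<epsilon>] unfolding A_def by (intro sum_mono) (simp add: \<U>_def)
  also have "\<dots> = exp (- 3 * \<delta> * n) * (\<Sum>U\<in>\<U>. (1 / 2) ^ card U * (2 * \<delta>) ^ segments U) * card ?P"
    by (simp only: sum_distrib_left sum_distrib_right)
  also have "\<dots> \<le> exp (- 3 * \<delta> * n) * exp (2 * \<delta> * n) * card ?P"
  proof (intro mult_right_mono mult_left_mono)
    have "(\<Sum>U\<in>\<U>. (1 / 2) ^ card U * (2 * \<delta>) ^ segments U)
        \<le> (\<Sum>U\<in>Pow {..<n}. (1 / 2) ^ card U * (2 * \<delta>) ^ segments U)"
      using \<delta> \<U> by (intro sum_mono2) auto
    also have "\<dots> \<le> (1 + 2 * \<delta>) ^ n" using \<delta> by (intro sum_segment_weights) auto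
    also have "\<dots> \<le> exp (2 * \<delta>) ^ n" using \<delta> by (intro power_mono) auto
    also have "\<dots> = exp (2 * \<delta> * n)" by (simp add: exp_of_nat_mult[symmetric] mult.commute)
    finally show "(\<Sum>U\<in>\<U>. (1 / 2) ^ card U * (2 * \<delta>) ^ segments U) \<le> exp (2 * \<delta> * n)" .
  qed auto
  also have "exp (- 3 * \<delta> * n) * exp (2 * \<delta> * n) = exp (- \<delta> * n)" by (simp add: exp_add[symmetric])
  finally show ?thesis .
qed

section \<open>The giant component\<close>

lemma pair_pmf_of_set:
  assumes "finite A" "A \<noteq> {}" "finite B" "B \<noteq> {}"
  shows "pair_pmf (pmf_of_set A) (pmf_of_set B) = pmf_of_set (A \<times> B)"
proof (rule pmf_eqI)
  fix x :: "'a \<times> 'b"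
  show "pmf (pair_pmf (pmf_of_set A) (pmf_of_set B)) x = pmf (pmf_of_set (A \<times> B)) x"
    using assms by (cases x) (simp add: pmf_pair pmf_of_set card_cartesian_product indicator_def)
qed

lemma prob_random_matching_and_order:
  assumes "even n"
  shows "measure_pmf.prob (random_matching_and_order n) {(M, \<pi>). Q M \<pi>}
    = (\<Sum>M\<in>perfect_matchings {..<n}. order_prob {..<n} (Q M)) / card (perfect_matchings {..<n})"
proof -
  let ?A = "perfect_matchings {..<n}" and ?B = "permutations_of_set {..<n}"
  have AB: "finite ?A" "?A \<noteq> {}" "finite ?B" "?B \<noteq> {}"
    using finite_perfect_matchings perfect_matchings_nonempty[OF assms] by auto
  have "(?A \<times> ?B) \<inter> {(M, \<pi>). Q M \<pi>} = (SIGMA M:?A. {\<pi> \<in> ?B. Q M \<pi>})" by auto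
  then have "card ((?A \<times> ?B) \<inter> {(M, \<pi>). Q M \<pi>}) = (\<Sum>M\<in>?A. card {\<pi> \<in> ?B. Q M \<pi>})"
    using AB by (simp add: card_SigmaI)
  moreover have "measure_pmf.prob (random_matching_and_order n) {(M, \<pi>). Q M \<pi>}
      = card ((?A \<times> ?B) \<inter> {(M, \<pi>). Q M \<pi>}) / card (?A \<times> ?B)"
    unfolding random_matching_and_order_def pair_pmf_of_set[OF AB]
    using AB by (intro measure_pmf_of_set) auto
  ultimately show ?thesis
    by (simp add: order_prob_eq_card sum_divide_distrib[symmetric] card_cartesian_product)
qed

text \<open>Exceptional matchings are charged probability 1, the others \<open>b\<close>, and the
  result is averaged over the matching.\<close>

lemma prob_random_matching_and_order_le:
  fixes a b :: real
  assumes "even n" "\<And>M. M \<in> perfect_matchings {..<n} - X \<Longrightarrow> order_prob {..<n} (Q M) \<le> b"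
    and "0 \<le> b" and X: "X \<subseteq> perfect_matchings {..<n}" "card X \<le> a * card (perfect_matchings {..<n})"
  shows "measure_pmf.prob (random_matching_and_order n) {(M, \<pi>). Q M \<pi>} \<le> a + b"
proof -
  let ?A = "perfect_matchings {..<n}"
  have A: "finite ?A" "card ?A > 0"
    using finite_perfect_matchings[of "{..<n}"] perfect_matchings_nonempty[OF assms(1)]
    by (auto simp: card_gt_0_iff)
  have one: "order_prob {..<n} R \<le> 1" for R
    using order_prob_mono[of "{..<n}" R "\<lambda>_. True"] by (simp add: order_prob_def order_mean_const)
  have "(\<Sum>M\<in>?A. order_prob {..<n} (Q M)) \<le> (\<Sum>M\<in>?A. of_bool (M \<in> X) + b)"
    using assms(2,3) one by (intro sum_mono) (auto intro: add_increasing2)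
  also have "\<dots> = card X + b * card ?A"
    using X(1) A(1) by (simp add: sum.distrib Int_absorb1)
  also have "\<dots> \<le> (a + b) * card ?A" using X(2) by (simp add: algebra_simps)
  finally show ?thesis
    unfolding prob_random_matching_and_order[OF assms(1)] using A(2) by (simp add: field_simps)
qed

text \<open>A ball of radius 2 has at most 16 vertices, and with probability at least \<open>1 / 16!\<close> the neighbours
  of its centre come last in it. In \<open>2048 = 2 * 256 * 4\<close>, half of the vertices are tree-like, one of
  the 256 colour classes is used, and a quarter of the mean is guaranteed by the tail bound.\<close>

definition isolated_density :: real where
  "isolated_density = 1 / fact 16 / 2048"

lemma isolated_density_pos: "0 < isolated_density"
  by (simp add: isolated_density_def)

lemma isolated_density_le_one: "isolated_density \<le> 1"
proof -
  have "1 / fact 16 \<le> (1 :: real)" by (simp add: fact_ge_1)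
  moreover have "x / 2048 \<le> 1" if "x \<le> 1" for x :: real using that by simp
  ultimately show ?thesis unfolding isolated_density_def by blast
qed

text \<open>For a matching with few short edges and no dense set, a missing giant forces an unlikely
  event of the ordering: too many vertices outside \<open>T3\<close>, or too few isolated
  ones.\<close>

lemma order_prob_no_giant_le:
  fixes n :: nat and \<delta> c1 :: real
  assumes c1: "c1 = isolated_density" and M: "M \<in> perfect_matchings {..<n}" and n: "8 \<le> n"
    and \<delta>: "0 < \<delta>" "\<delta> \<le> c1 / 4" "4 \<le> c1 * \<delta> * n"
    and short: "card (M \<inter> short_pairs n) \<le> c1 / 32 * n"
    and sparse: "\<not> (\<exists>U\<subseteq>{..<n}. \<delta> * n \<le> card U \<and> card U \<le> 2 * (\<delta> * n)
      \<and> segments U + c1 / 4 * card U \<le> card (M \<inter> Pow U))"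
  shows "order_prob {..<n} (\<lambda>\<pi>. \<not> (let E = cycle_edges n \<union> M; S = T3 {..<n} E \<pi> in
      \<exists>K \<in> connected_components S (induced_edges E S). real (card K) \<ge> \<delta> * real n))
    \<le> 16 * exp (- ((c1 / 256)\<^sup>2 / 8) * n) + exp (- c1 * n)"
proof -
  interpret cycle_plus_matching n M using M n by unfold_locales auto
  note c1' = isolated_density_pos[folded c1] isolated_density_le_one[folded c1]
  have half: "real n / 2 \<le> card {v \<in> {..<n}. tree_like v}"
  proof -
    have "{..<n} = {v \<in> {..<n}. tree_like v} \<union> {v \<in> {..<n}. \<not> tree_like v}" by auto
    then have "n \<le> card {v \<in> {..<n}. tree_like v} + card {v \<in> {..<n}. \<not> tree_like v}"
      by (metis card_Un_le card_lessThan)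
    then have "real n \<le> card {v \<in> {..<n}. tree_like v} + 8 * real (card (M \<inter> short_pairs n))"
      using card_not_tree_like by linarith
    moreover have "c1 / 32 * n \<le> 1 / 32 * n" using c1' by (intro mult_right_mono) auto
    ultimately show ?thesis using short by linarith
  qed
  \<comment> \<open>With \<open>t = c1 / 256\<close>, four times the bound is
    \<open>(1 + c1 / 4) * n\<close>, which gives \<open>\<beta> = c1 / 4\<close>.\<close>
  let ?many = "\<lambda>\<pi>. real n / 4 + 16 * (c1 / 256) * n \<le> card ({..<n} - T3 {..<n} edges \<pi>)"
  let ?few = "\<lambda>\<pi>. card {v \<in> T3 {..<n} edges \<pi>. nbrs v \<inter> T3 {..<n} edges \<pi> = {}} \<le> c1 * real n"
  have "?many \<pi> \<or> ?few \<pi>"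
    if "\<not> (let E = cycle_edges n \<union> M; S = T3 {..<n} E \<pi> in
      \<exists>K \<in> connected_components S (induced_edges E S). real (card K) \<ge> \<delta> * real n)" for \<pi>
  proof (rule ccontr)
    assume neg: "\<not> (?many \<pi> \<or> ?few \<pi>)"
    let ?S = "T3 {..<n} edges \<pi>"
    have "card K \<le> \<delta> * n" if "K \<in> connected_components ?S (induced_edges edges ?S)" for K
      using that \<open>\<not> (let E = cycle_edges n \<union> M; S = T3 {..<n} E \<pi> in _ E S)\<close>
      by (auto simp: Let_def not_le)
    \<comment> \<open>The short edges give \<open>\<alpha> = 8 * (c1 / 32)\<close>. Each of
      \<open>\<delta>\<close>, \<open>\<alpha>\<close>, \<open>\<beta>\<close> is at most
      \<open>c1 / 4\<close>, so together with \<open>\<epsilon> = c1\<close> they stay below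
      \<open>2 * c1\<close>.\<close>
    then have "\<exists>U\<subseteq>{..<n}. \<delta> * n \<le> card U \<and> card U \<le> 2 * (\<delta> * n)
      \<and> segments U + c1 / 4 * card U \<le> card (M \<inter> Pow U)"
      using short neg c1' \<delta>
      by (intro small_components_dense_set[where \<alpha> = "c1 / 4" and \<beta> = "c1 / 4" and \<epsilon> = c1
          and \<delta> = \<delta> and ?c1.0 = c1 and \<pi> = \<pi>]) (auto simp: algebra_simps)
    then show False using sparse by blast
  qed
  then have "order_prob {..<n} (\<lambda>\<pi>. \<not> (let E = cycle_edges n \<union> M; S = T3 {..<n} E \<pi> in
      \<exists>K \<in> connected_components S (induced_edges E S). real (card K) \<ge> \<delta> * real n))
      \<le> order_prob {..<n} (\<lambda>\<pi>. ?many \<pi> \<or> ?few \<pi>)"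
    by (intro order_prob_mono)
  also have "\<dots> \<le> order_prob {..<n} ?many + order_prob {..<n} ?few" by (rule order_prob_disj_le)
  also have "order_prob {..<n} ?many \<le> 16 * exp (- ((c1 / 256)\<^sup>2 / 8) * n)"
    using c1' by (intro order_prob_many_outside_T3) auto
  also have "order_prob {..<n} ?few \<le> exp (- c1 * n)"
    using order_prob_few_isolated[OF half] unfolding c1 isolated_density_def .
  finally show ?thesis by simp
qed

theorem theorem3p3:
  "\<exists>(\<delta>::real)>0. \<exists>(c::real)>0. \<forall>\<^sub>F n in sequentially. even n \<longrightarrow>
     measure_pmf.prob (random_matching_and_order n)
       {(M, \<pi>). let E = cycle_edges n \<union> M; S = T3 {..<n} E \<pi> in
          \<exists>K \<in> connected_components S (induced_edges E S). real (card K) \<ge> \<delta> * real n}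
     \<ge> 1 - exp (- c * real n)"
proof -
  define c1 :: real where "c1 = isolated_density"
  note c1 = isolated_density_pos[folded c1_def] isolated_density_le_one[folded c1_def]
  \<comment> \<open>The first bound ensures \<open>\<delta> \<le> 1 / 32\<close> and
    \<open>\<delta> \<le> c1 / 4\<close>; the second is the condition of
    \<open>card_matchings_some_dense_set\<close> for \<open>\<epsilon> = c1\<close>.\<close>
  define \<delta> where "\<delta> = min (c1 / 32) (exp (- (28 / c1)) / 2)"
  have \<delta>: "0 < \<delta>" "\<delta> \<le> c1 / 32" "\<delta> \<le> exp (- (28 / c1)) / 2"
    using c1 by (auto simp: \<delta>_def)
  \<comment> \<open>The slowest decay rate: \<open>\<delta>\<close> is that of dense sets and the
    other that of the upper tail with \<open>t = c1 / 256\<close>. The rates \<open>c1 / 64\<close>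
    and \<open>c1\<close> are no smaller.\<close>
  define c0 where "c0 = min \<delta> ((c1 / 256)\<^sup>2 / 8)"
  have c0: "0 < c0" "c0 \<le> \<delta>" "c0 \<le> (c1 / 256)\<^sup>2 / 8" using \<delta> c1 by (auto simp: c0_def)
  let ?good = "\<lambda>n M \<pi>. let E = cycle_edges n \<union> M; S = T3 {..<n} E \<pi> in
    \<exists>K \<in> connected_components S (induced_edges E S). real (card K) \<ge> \<delta> * real n"
  have main: "1 - exp (- (c0 / 2) * n)
      \<le> measure_pmf.prob (random_matching_and_order n) {(M, \<pi>). ?good n M \<pi>}"
    if even: "even n" and n: "8 \<le> n" "4 / (c1 * \<delta>) \<le> n" "(2 / c0) * (exp 32 + 18) \<le> n" for n
  proof -
    let ?P = "perfect_matchings {..<n}"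
    define k where "k = nat \<lceil>c1 / 32 * n\<rceil>"
    define A1 where "A1 = {M \<in> ?P. k \<le> card (M \<inter> short_pairs n)}"
    define A2 where "A2 = {M \<in> ?P. \<exists>U\<subseteq>{..<n}. \<delta> * n \<le> card U \<and> card U \<le> 2 * (\<delta> * n)
      \<and> segments U + c1 / 4 * card U \<le> card (M \<inter> Pow U)}"
    have shrink: "exp (- a * n) \<le> exp (- c0 * n)" if "c0 \<le> a" for a
      using mult_right_mono[OF that, of "real n"] by simp
    have kn: "c1 / 32 * n \<le> k" "k < c1 / 32 * n + 1"
    proof -
      have "0 \<le> c1 / 32 * n" using c1 by simp
      then show "c1 / 32 * n \<le> k" "k < c1 / 32 * n + 1" unfolding k_def by linarith+
    qed
    have "c1 / 32 * n \<le> 1 / 32 * n" using c1 by (intro mult_right_mono) auto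
    then have "4 * k \<le> n" using kn(2) n(1) by linarith
    then have "real (card A1) \<le> exp 32 * (1 / 2) ^ k * card ?P"
      unfolding A1_def by (rule card_matchings_many_short[OF n(1)])
    moreover have "exp 32 * (1 / 2) ^ k * card ?P \<le> exp 32 * exp (- c0 * n) * card ?P"
    proof -
      \<comment> \<open>The power of \<open>1 / 2\<close> becomes
        \<open>exp (- (real k / 2))\<close>, and \<open>k \<ge> c1 / 32 * n\<close> turns this into
        the rate \<open>c1 / 64\<close>.\<close>
      have "1 / 2 \<le> exp (- (1 / 2) :: real)" using exp_half_le2 by (simp add: exp_minus field_simps)
      then have "(1 / 2) ^ k \<le> exp (- (1 / 2) :: real) ^ k" by (intro power_mono) auto
      also have "\<dots> = exp (- (real k / 2))" by (simp add: exp_of_nat_mult[symmetric])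
      also have "\<dots> \<le> exp (- (c1 / 64) * n)" using kn(1) by simp
      also have "\<dots> \<le> exp (- c0 * n)"
      proof (rule shrink)
        have "(c1 / 256)\<^sup>2 / 8 \<le> c1 / 64"
          using c1 mult_mono[of c1 1 c1 c1] by (simp add: power2_eq_square field_simps)
        then show "c0 \<le> c1 / 64" using c0 by linarith
      qed
      finally show ?thesis by (intro mult_right_mono mult_left_mono) auto
    qed
    ultimately have A1: "real (card A1) \<le> exp 32 * exp (- c0 * n) * card ?P" by linarith
    have "real (card A2) \<le> exp (- \<delta> * n) * card ?P"
      unfolding A2_def using c1 \<delta> by (intro card_matchings_some_dense_set[OF n(1)]) auto
    also have "\<dots> \<le> exp (- c0 * n) * card ?P" using shrink[OF c0(2)] by (intro mult_right_mono) auto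
    finally have A2: "real (card A2) \<le> exp (- c0 * n) * card ?P" .
    have "card (A1 \<union> A2) \<le> card A1 + card A2" by (rule card_Un_le)
    then have A12: "real (card (A1 \<union> A2)) \<le> (exp 32 + 1) * exp (- c0 * n) * card ?P"
      using A1 A2 by (simp add: algebra_simps)
    have ord: "order_prob {..<n} (\<lambda>\<pi>. \<not> ?good n M \<pi>) \<le> 17 * exp (- c0 * n)"
      if M: "M \<in> ?P - (A1 \<union> A2)" for M
    proof -
      have "order_prob {..<n} (\<lambda>\<pi>. \<not> ?good n M \<pi>)
          \<le> 16 * exp (- ((c1 / 256)\<^sup>2 / 8) * n) + exp (- c1 * n)"
      proof (rule order_prob_no_giant_le[OF c1_def _ n(1) \<delta>(1)])
        show "M \<in> ?P" using M by blast
        show "\<delta> \<le> c1 / 4" using \<delta>(2) c1 by linarith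
        show "4 \<le> c1 * \<delta> * n" using n(2) c1 \<delta>(1) by (simp add: field_simps)
        have "card (M \<inter> short_pairs n) < k" using M by (auto simp: A1_def)
        then show "card (M \<inter> short_pairs n) \<le> c1 / 32 * n"
          unfolding k_def by (simp add: zless_nat_eq_int_zless less_ceiling_iff)
        show "\<not> (\<exists>U\<subseteq>{..<n}. \<delta> * n \<le> card U \<and> card U \<le> 2 * (\<delta> * n)
          \<and> segments U + c1 / 4 * card U \<le> card (M \<inter> Pow U))"
          using M by (simp add: A2_def)
      qed
      moreover have "c0 \<le> c1" using c0(2) \<delta>(2) c1 by linarith
      ultimately show ?thesis using shrink[OF c0(3)] shrink[of c1] by linarith
    qed
    have "measure_pmf.prob (random_matching_and_order n) {(M, \<pi>). \<not> ?good n M \<pi>}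
        \<le> (exp 32 + 1) * exp (- c0 * n) + 17 * exp (- c0 * n)"
      by (rule prob_random_matching_and_order_le[OF even ord _ _ A12]) (auto simp: A1_def A2_def)
    \<comment> \<open>Short edges contribute \<open>exp 32\<close>, dense sets 1, and the ordering
      \<open>16 + 1\<close>. Half of the rate \<open>c0\<close> is then spent on absorbing this
      constant.\<close>
    also have "\<dots> = (exp 32 + 18) * exp (- c0 * n)" by (simp add: algebra_simps)
    also have "\<dots> \<le> exp (c0 / 2 * n) * exp (- c0 * n)"
    proof (rule mult_right_mono)
      have "exp 32 + 18 \<le> c0 / 2 * n" using n(3) c0(1) by (simp add: field_simps)
      also have "\<dots> \<le> exp (c0 / 2 * n)" using exp_ge_add_one_self[of "c0 / 2 * n"] by linarith
      finally show "exp 32 + 18 \<le> exp (c0 / 2 * n)" .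
    qed simp
    also have "\<dots> = exp (- (c0 / 2) * n)" by (simp add: exp_add[symmetric])
    finally have "measure_pmf.prob (random_matching_and_order n) {(M, \<pi>). \<not> ?good n M \<pi>}
        \<le> exp (- (c0 / 2) * n)" .
    moreover have "{(M, \<pi>). \<not> ?good n M \<pi>} = UNIV - {(M, \<pi>). ?good n M \<pi>}" by auto
    ultimately show ?thesis
      using measure_pmf.prob_compl[of "{(M, \<pi>). ?good n M \<pi>}" "random_matching_and_order n"]
      by simp
  qed
  have "\<forall>\<^sub>F n in sequentially. even n \<longrightarrow> 1 - exp (- (c0 / 2) * real n)
      \<le> measure_pmf.prob (random_matching_and_order n) {(M, \<pi>). ?good n M \<pi>}"
    using eventually_ge_at_top[of "8 :: nat"]
      eventually_ge_at_top[of "nat \<lceil>4 / (c1 * \<delta>)\<rceil>"] eventually_ge_at_top[of "nat \<lceil>(2 / c0) * (exp 32 + 18)\<rceil>"]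
  proof eventually_elim
    case (elim n)
    then show ?case by (intro impI main) (auto simp: nat_le_iff ceiling_le_iff)
  qed
  then show ?thesis using \<delta>(1) c0(1) by (intro exI[of _ \<delta>] conjI exI[of _ "c0 / 2"]) auto
qed

end
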